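(* Let $\pi:M\to\mathbb{R}$ be a smooth fibred manifold with $\dim M=n+1$, and let $S$ be a semispray on $J^1\pi$. Let $\Lambda^1_S(J^1\pi)$ be the set of semi-basic, non-degenerate $1$-forms $\theta$ on $J^1\pi$ with $\mathcal{L}_Sd\theta=0$. (i) $S$ is a Lagrangian vector field if and only if there exists $\theta\in\Lambda^1_S(J^1\pi)$ such that $d_J\theta=0$. In this case $\theta=\theta_L$ for some locally defined Lagrangian function $L$, and $\mathcal{L}_S\theta=dL$. (ii) $S$ is a conservative Lagrangian vector field if and only if there exists $\theta\in\Lambda^1_S(J^1\pi)$ such that $d_J\theta\neq 0$. In this case $\theta=\theta_L+f\,dt$ for some locally defined Lagrangian function $L$ and $f$ a conservation law for $S$.
   Context: Everything is $C^\infty$. $\pi:M\to\mathbb{R}$ is a fibred manifold with $\dim M=n+1$, $J^1\pi$ is the first jet bundle of $\pi$, and $\pi_{10}:J^1\pi\to M$ is the projection $j^1_t\gamma\mapsto\gamma(t)$. Coordinates $(t,x^i)$ on $M$ ($t$ the global coordinate of $\mathbb{R}$) induce coordinates $(t,x^i,y^i)$ on $J^1\pi$. Put $\delta x^i=dx^i-y^i\,dt$. Vertical vectors are those in $\operatorname{Ker}D\pi_{10}$, spanned by $\partial/\partial y^i$. The vertical endomorphism is $J=\frac{\partial}{\partial y^i}\otimes\delta x^i$. A semispray is a globally defined vector field $S$ on $J^1\pi$ with $J(S)=0$ and $dt(S)=1$. For a $(1,1)$-tensor field $A$ and a $k$-form $\omega$: $i_A\omega(X_1,\dots,X_k)=\sum_{j}\omega(X_1,\dots,AX_j,\dots,X_k)$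 (and $i_A\omega=0$ if $k=0$), and $d_A\omega=i_Ad\omega-d\,i_A\omega$. A $1$-form is semi-basic if it vanishes on vertical vectors. A semi-basic $1$-form $\theta$ on $J^1\pi$ is non-degenerate if the $2$-form $d\theta+i_Sd\theta\wedge dt$ has rank $2n$ on $J^1\pi$. A Lagrangian function is a smooth function $L$ on $J^1\pi$ (possibly only locally defined); its Poincaré–Cartan $1$-form is $\theta_L=L\,dt+d_JL$. $L$ is regular if $d\theta_L$ has maximal rank $2n$. $S$ is a Lagrangian vector field if there exists a (locally defined) regular Lagrangian $L$ with $\mathcal{L}_S\theta_L=dL$. A first integral (conservation law) of $S$ is a function $f$ with $S(f)=0$. On $\Lambda^1_S(J^1\pi)$ one uses the equivalence relation $\theta_1\equiv\theta_2$ iff $\theta_1\wedge dt=\theta_2\wedge dt$ and $S(i_S(\theta_1-\theta_2))=0$, i.e. iff $\theta_1=\theta_2+f\,dt$ for a first integral $f$ of $S$; each class contains exactly one Poincaré–Cartan form $\theta_L$. A Lagrangian vector field $S$ is termed conservative when some equivalence class $[\theta_L]$ contains a semi-basic $1$-form $\theta$ that is not $d_J$-closed, in which case $i_S\theta-L$ is a first integral of $S$ and $i_Sd\theta$ is a dual symmetry of $S$ (a $1$-form $\omega$ with $\mathcal{L}_S\omega=0$). *)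

theory Defs
  imports "HOL-Analysis.Analysis" "HOL-Library.Function_Algebras"
begin

section \<open>Smooth maps between normed spaces\<close>

text \<open>
  Continuous differentiability of order \<open>k\<close> through iterated directional derivatives.  The notion is
  meant for open \<open>U\<close> and a finite-dimensional domain, where it is the usual \<open>C\<^sup>k\<close>.
\<close>

fun Ck_on :: "nat \<Rightarrow> 'a::real_normed_vector set \<Rightarrow> ('a \<Rightarrow> 'b::real_normed_vector) \<Rightarrow> bool" where
  "Ck_on 0 U f \<longleftrightarrow> continuous_on U f"
| "Ck_on (Suc k) U f \<longleftrightarrow>
     (\<forall>x\<in>U. f differentiable at x) \<and> (\<forall>v. Ck_on k U (\<lambda>x. frechet_derivative f (at x) v))"

definition smooth_on :: "'a::real_normed_vector set \<Rightarrow> ('a \<Rightarrow> 'b::real_normed_vector) \<Rightarrow> bool" where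
  "smooth_on U f \<longleftrightarrow> (\<forall>k. Ck_on k U f)"

section \<open>Manifolds fibred over the real line\<close>

text \<open>
  The manifold \<open>M\<close> is a whole (Hausdorff, second countable) type \<open>'m\<close>; it is modelled on
  \<open>\<real> \<times> \<real>\<^sup>n\<close> with \<open>n = CARD('n)\<close>, so that \<open>dim M = n + 1\<close>.  A chart is a pair \<open>(U, \<phi>)\<close>; only the values
  of \<open>\<phi>\<close> on \<open>U\<close> matter.
\<close>

type_synonym 'n mspace = "real \<times> (real^'n)"
type_synonym ('m, 'n) chart = "'m set \<times> ('m \<Rightarrow> 'n mspace)"

record ('m, 'n) fibration =
  atlas :: "('m, 'n) chart set"
  proj :: "'m \<Rightarrow> real"

definition is_chart :: "('m::topological_space, 'n::finite) chart \<Rightarrow> bool" where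
  "is_chart c \<longleftrightarrow> (case c of (U, \<phi>) \<Rightarrow>
     open U \<and> open (\<phi> ` U) \<and> homeomorphism U (\<phi> ` U) \<phi> (inv_into U \<phi>))"

definition compatible :: "('m, 'n::finite) chart \<Rightarrow> ('m, 'n) chart \<Rightarrow> bool" where
  "compatible c c' \<longleftrightarrow> (case (c, c') of ((U, \<phi>), (V, \<psi>)) \<Rightarrow>
     smooth_on (\<phi> ` (U \<inter> V)) (\<psi> \<circ> inv_into U \<phi>) \<and>
     smooth_on (\<psi> ` (U \<inter> V)) (\<phi> \<circ> inv_into V \<psi>))"

definition smooth_atlas :: "('m::topological_space, 'n::finite) chart set \<Rightarrow> bool" where
  "smooth_atlas A \<longleftrightarrow>
     (\<forall>c\<in>A. is_chart c) \<and> (\<Union>c\<in>A. fst c) = UNIV \<and> (\<forall>c\<in>A. \<forall>c'\<in>A. compatible c c')"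

definition max_atlas :: "('m::topological_space, 'n::finite) chart set \<Rightarrow> ('m, 'n) chart set" where
  "max_atlas A = {c. is_chart c \<and> (\<forall>a\<in>A. compatible c a)}"

definition fibred_manifold ::
  "('m::{t2_space, second_countable_topology}, 'n::finite) fibration \<Rightarrow> bool" where
  "fibred_manifold F \<longleftrightarrow>
     smooth_atlas (atlas F) \<and> surj (proj F) \<and>
     (\<forall>(U, \<phi>)\<in>atlas F. smooth_on (\<phi> ` U) (proj F \<circ> inv_into U \<phi>) \<and>
        (\<forall>p\<in>U. surj (frechet_derivative (proj F \<circ> inv_into U \<phi>) (at (\<phi> p)))))"

text \<open>The charts \<open>(t, x\<^sup>i)\<close> whose first coordinate is the global coordinate of \<open>\<real>\<close>.\<close>

definition adapted :: "('m::topological_space, 'n::finite) fibration \<Rightarrow> ('m, 'n) chart set" where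
  "adapted F = {c \<in> max_atlas (atlas F). \<forall>p\<in>fst c. fst (snd c p) = proj F p}"

section \<open>The first jet bundle\<close>

definition local_section ::
  "('m::topological_space, 'n::finite) fibration \<Rightarrow> real \<Rightarrow> (real \<Rightarrow> 'm) \<Rightarrow> bool" where
  "local_section F t \<gamma> \<longleftrightarrow> (\<exists>I. open I \<and> t \<in> I \<and> continuous_on I \<gamma> \<and> (\<forall>s\<in>I. proj F (\<gamma> s) = s) \<and>
     (\<forall>(U, \<phi>)\<in>atlas F. smooth_on {s\<in>I. \<gamma> s \<in> U} (\<phi> \<circ> \<gamma>)))"

definition same_jet ::
  "('m, 'n::finite) fibration \<Rightarrow> real \<Rightarrow> (real \<Rightarrow> 'm) \<Rightarrow> (real \<Rightarrow> 'm) \<Rightarrow> bool" where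
  "same_jet F t \<gamma> \<gamma>' \<longleftrightarrow> \<gamma> t = \<gamma>' t \<and>
     (\<forall>(U, \<phi>)\<in>atlas F. \<gamma> t \<in> U \<longrightarrow>
        vector_derivative (\<phi> \<circ> \<gamma>) (at t) = vector_derivative (\<phi> \<circ> \<gamma>') (at t))"

text \<open>
  \<open>j\<^sup>1\<^sub>t\<gamma>\<close> is the equivalence class of \<open>\<gamma>\<close> at \<open>t\<close>; the parameter \<open>t\<close> is recorded in every
  representative.
\<close>

type_synonym 'm jet = "(real \<times> (real \<Rightarrow> 'm)) set"

definition jet1 ::
  "('m::topological_space, 'n::finite) fibration \<Rightarrow> real \<Rightarrow> (real \<Rightarrow> 'm) \<Rightarrow> 'm jet" where
  "jet1 F t \<gamma> = {(t, \<gamma>') |\<gamma>'. local_section F t \<gamma>' \<and> same_jet F t \<gamma> \<gamma>'}"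

definition J1 :: "('m::topological_space, 'n::finite) fibration \<Rightarrow> 'm jet set" where
  "J1 F = {jet1 F t \<gamma> |t \<gamma>. local_section F t \<gamma>}"

definition jet_proj :: "'m jet \<Rightarrow> 'm" where
  "jet_proj j = (case SOME r. r \<in> j of (t, \<gamma>) \<Rightarrow> \<gamma> t)"

text \<open>The coordinates \<open>(t, x\<^sup>i, y\<^sup>i)\<close> induced by an adapted chart.\<close>

type_synonym 'n jspace = "real \<times> (real^'n) \<times> (real^'n)"

definition jet_dom ::
  "('m::topological_space, 'n::finite) fibration \<Rightarrow> ('m, 'n) chart \<Rightarrow> 'm jet set" where
  "jet_dom F c = {j \<in> J1 F. jet_proj j \<in> fst c}"

definition jet_coords :: "('m, 'n::finite) chart \<Rightarrow> 'm jet \<Rightarrow> 'n jspace" where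
  "jet_coords c j = (case SOME r. r \<in> j of (t, \<gamma>) \<Rightarrow>
     (t, snd (snd c (\<gamma> t)), vector_derivative (\<lambda>s. snd (snd c (\<gamma> s))) (at t)))"

definition jet_point ::
  "('m::topological_space, 'n::finite) fibration \<Rightarrow> ('m, 'n) chart \<Rightarrow> 'n jspace \<Rightarrow> 'm jet" where
  "jet_point F c = inv_into (jet_dom F c) (jet_coords c)"

text \<open>The coordinate image of \<open>W \<subseteq> J\<^sup>1\<pi>\<close> in an adapted chart.\<close>

definition jet_img ::
  "('m::topological_space, 'n::finite) fibration \<Rightarrow> 'm jet set \<Rightarrow> ('m, 'n) chart \<Rightarrow> 'n jspace set" where
  "jet_img F W c = jet_coords c ` (W \<inter> jet_dom F c)"

definition jet_open :: "('m::topological_space, 'n::finite) fibration \<Rightarrow> 'm jet set \<Rightarrow> bool" where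
  "jet_open F W \<longleftrightarrow> W \<subseteq> J1 F \<and> (\<forall>c\<in>adapted F. open (jet_img F W c))"

text \<open>Derivative at the jet \<open>j\<close> of the change of induced coordinates from \<open>c\<close> to \<open>c'\<close>.\<close>

definition jet_trans ::
  "('m::topological_space, 'n::finite) fibration \<Rightarrow> ('m, 'n) chart \<Rightarrow> ('m, 'n) chart \<Rightarrow> 'm jet \<Rightarrow>
     'n jspace \<Rightarrow> 'n jspace" where
  "jet_trans F c c' j =
     frechet_derivative (jet_coords c' \<circ> jet_point F c) (at (jet_coords c j))"

section \<open>Functions, vector fields and forms on open subsets of the jet bundle\<close>

text \<open>
  Vector fields, \<open>(1,1)\<close>-tensor fields and differential forms are given by their representatives in
  all adapted charts; a \<open>k\<close>-form takes its \<open>k\<close> vector arguments as a list.  The operations below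
  act on the representatives chart by chart, so the chart argument is merely passed along.
\<close>

type_synonym ('m, 'n) jform = "('m, 'n) chart \<Rightarrow> 'n jspace \<Rightarrow> 'n jspace list \<Rightarrow> real"
type_synonym ('m, 'n) jvec = "('m, 'n) chart \<Rightarrow> 'n jspace \<Rightarrow> 'n jspace"
type_synonym ('m, 'n) jendo = "('m, 'n) chart \<Rightarrow> 'n jspace \<Rightarrow> 'n jspace \<Rightarrow> 'n jspace"

text \<open>Equality of \<open>k\<close>-forms on \<open>W\<close>.\<close>

definition form_eq ::
  "('m::topological_space, 'n::finite) fibration \<Rightarrow> nat \<Rightarrow> 'm jet set \<Rightarrow>
     ('m, 'n) jform \<Rightarrow> ('m, 'n) jform \<Rightarrow> bool" where
  "form_eq F k W \<alpha> \<beta> \<longleftrightarrow>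
     (\<forall>c\<in>adapted F. \<forall>x\<in>jet_img F W c. \<forall>vs. length vs = k \<longrightarrow> \<alpha> c x vs = \<beta> c x vs)"

text \<open>A function on jets, regarded as a \<open>0\<close>-form.\<close>

definition fn ::
  "('m::topological_space, 'n::finite) fibration \<Rightarrow> ('m jet \<Rightarrow> real) \<Rightarrow> ('m, 'n) jform" where
  "fn F f c x vs = f (jet_point F c x)"

definition smooth_fn ::
  "('m::topological_space, 'n::finite) fibration \<Rightarrow> 'm jet set \<Rightarrow> ('m jet \<Rightarrow> real) \<Rightarrow> bool" where
  "smooth_fn F W f \<longleftrightarrow> (\<forall>c\<in>adapted F. smooth_on (jet_img F W c) (f \<circ> jet_point F c))"

definition vector_field ::
  "('m::topological_space, 'n::finite) fibration \<Rightarrow> 'm jet set \<Rightarrow> ('m, 'n) jvec \<Rightarrow> bool" where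
  "vector_field F W X \<longleftrightarrow>
     (\<forall>c\<in>adapted F. smooth_on (jet_img F W c) (X c)) \<and>
     (\<forall>c\<in>adapted F. \<forall>c'\<in>adapted F. \<forall>j\<in>W \<inter> jet_dom F c \<inter> jet_dom F c'.
        X c' (jet_coords c' j) = jet_trans F c c' j (X c (jet_coords c j)))"

definition one_form ::
  "('m::topological_space, 'n::finite) fibration \<Rightarrow> 'm jet set \<Rightarrow> ('m, 'n) jform \<Rightarrow> bool" where
  "one_form F W \<theta> \<longleftrightarrow>
     (\<forall>c\<in>adapted F. (\<forall>x\<in>jet_img F W c. linear (\<lambda>v. \<theta> c x [v])) \<and>
        (\<forall>v. smooth_on (jet_img F W c) (\<lambda>x. \<theta> c x [v]))) \<and>
     (\<forall>c\<in>adapted F. \<forall>c'\<in>adapted F. \<forall>j\<in>W \<inter> jet_dom F c \<inter> jet_dom F c'. \<forall>v.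
        \<theta> c' (jet_coords c' j) [jet_trans F c c' j v] = \<theta> c (jet_coords c j) [v])"

definition omit :: "nat \<Rightarrow> 'a list \<Rightarrow> 'a list" where
  "omit i vs = take i vs @ drop (Suc i) vs"

text \<open>
  The vector arguments are constant in the coordinates, so no bracket terms occur.  Convention:
  \<open>d\<theta>(X, Y) = X(\<theta>(Y)) - Y(\<theta>(X)) - \<theta>([X, Y])\<close> and \<open>\<alpha> \<and> \<beta> = \<alpha> \<otimes> \<beta> - \<beta> \<otimes> \<alpha>\<close> for \<open>1\<close>-forms.
\<close>

definition ext_d :: "('m, 'n::finite) jform \<Rightarrow> ('m, 'n) jform" where
  "ext_d \<omega> c x vs =
     (\<Sum>i<length vs. (-1) ^ i * frechet_derivative (\<lambda>z. \<omega> c z (omit i vs)) (at x) (vs ! i))"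

definition contr :: "('m, 'n::finite) jvec \<Rightarrow> ('m, 'n) jform \<Rightarrow> ('m, 'n) jform" where
  "contr X \<omega> c x vs = \<omega> c x (X c x # vs)"

text \<open>Wedge product of a form with a \<open>1\<close>-form on the right.\<close>

definition wedge1 :: "('m, 'n::finite) jform \<Rightarrow> ('m, 'n) jform \<Rightarrow> ('m, 'n) jform" where
  "wedge1 \<omega> \<alpha> c x vs =
     (\<Sum>i<length vs. (-1) ^ (length vs - Suc i) * \<omega> c x (omit i vs) * \<alpha> c x [vs ! i])"

text \<open>Product of a \<open>0\<close>-form with a form.\<close>

definition fmult :: "('m, 'n::finite) jform \<Rightarrow> ('m, 'n) jform \<Rightarrow> ('m, 'n) jform" where
  "fmult f \<omega> c x vs = f c x [] * \<omega> c x vs"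

text \<open>The Lie derivative in coordinates; for a \<open>0\<close>-form it is the derivative along \<open>X\<close>.\<close>

definition lie :: "('m, 'n::finite) jvec \<Rightarrow> ('m, 'n) jform \<Rightarrow> ('m, 'n) jform" where
  "lie X \<omega> c x vs =
     frechet_derivative (\<lambda>z. \<omega> c z vs) (at x) (X c x) +
     (\<Sum>i<length vs. \<omega> c x (vs[i := frechet_derivative (X c) (at x) (vs ! i)]))"

definition ins :: "('m, 'n::finite) jendo \<Rightarrow> ('m, 'n) jform \<Rightarrow> ('m, 'n) jform" where
  "ins A \<omega> c x vs = (\<Sum>i<length vs. \<omega> c x (vs[i := A c x (vs ! i)]))"

definition d_endo :: "('m, 'n::finite) jendo \<Rightarrow> ('m, 'n) jform \<Rightarrow> ('m, 'n) jform" where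
  "d_endo A \<omega> = ins A (ext_d \<omega>) - ext_d (ins A \<omega>)"

text \<open>
  Rank of the bilinear form \<open>\<omega>\<close> at the point with coordinates \<open>x\<close>: the codimension of its kernel.
\<close>

definition form_rank :: "('m, 'n::finite) jform \<Rightarrow> ('m, 'n) chart \<Rightarrow> 'n jspace \<Rightarrow> nat" where
  "form_rank \<omega> c x = DIM('n jspace) - dim {v. \<forall>w. \<omega> c x [v, w] = 0}"

definition has_rank ::
  "('m::topological_space, 'n::finite) fibration \<Rightarrow> 'm jet set \<Rightarrow> ('m, 'n) jform \<Rightarrow> nat \<Rightarrow> bool" where
  "has_rank F W \<omega> r \<longleftrightarrow> (\<forall>c\<in>adapted F. \<forall>x\<in>jet_img F W c. form_rank \<omega> c x = r)"

section \<open>Canonical objects on the jet bundle and semisprays\<close>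

definition dt :: "('m, 'n::finite) jform" where
  "dt c x vs = fst (hd vs)"

text \<open>\<open>J = \<partial>/\<partial>y\<^sup>i \<otimes> (dx\<^sup>i - y\<^sup>i dt)\<close>.\<close>

definition vert_endo :: "('m, 'n::finite) jendo" where
  "vert_endo c = (\<lambda>(t, x, y) (a, b, w). (0, 0, b - a *\<^sub>R y))"

abbreviation d_J :: "('m, 'n::finite) jform \<Rightarrow> ('m, 'n) jform" where
  "d_J \<equiv> d_endo vert_endo"

definition semispray ::
  "('m::topological_space, 'n::finite) fibration \<Rightarrow> ('m, 'n) jvec \<Rightarrow> bool" where
  "semispray F S \<longleftrightarrow> vector_field F (J1 F) S \<and>
     (\<forall>c\<in>adapted F. \<forall>x\<in>jet_img F (J1 F) c. vert_endo c x (S c x) = 0 \<and> dt c x [S c x] = 1)"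

text \<open>The vertical vectors are those of the form \<open>(0, 0, w)\<close> in induced coordinates.\<close>

definition semi_basic ::
  "('m::topological_space, 'n::finite) fibration \<Rightarrow> 'm jet set \<Rightarrow> ('m, 'n) jform \<Rightarrow> bool" where
  "semi_basic F W \<theta> \<longleftrightarrow> (\<forall>c\<in>adapted F. \<forall>x\<in>jet_img F W c. \<forall>w. \<theta> c x [(0, 0, w)] = 0)"

definition nondegenerate ::
  "('m::topological_space, 'n::finite) fibration \<Rightarrow> ('m, 'n) jvec \<Rightarrow> 'm jet set \<Rightarrow>
     ('m, 'n) jform \<Rightarrow> bool" where
  "nondegenerate F S W \<theta> \<longleftrightarrow>
     has_rank F W (ext_d \<theta> + wedge1 (contr S (ext_d \<theta>)) dt) (2 * CARD('n))"

text \<open>\<open>\<Lambda>\<^sup>1\<^sub>S(W)\<close> for an open \<open>W \<subseteq> J\<^sup>1\<pi>\<close>.\<close>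

definition Lambda1 ::
  "('m::topological_space, 'n::finite) fibration \<Rightarrow> ('m, 'n) jvec \<Rightarrow> 'm jet set \<Rightarrow>
     ('m, 'n) jform set" where
  "Lambda1 F S W = {\<theta>. one_form F W \<theta> \<and> semi_basic F W \<theta> \<and> nondegenerate F S W \<theta> \<and>
     form_eq F 2 W (lie S (ext_d \<theta>)) 0}"

definition first_integral ::
  "('m::topological_space, 'n::finite) fibration \<Rightarrow> ('m, 'n) jvec \<Rightarrow> 'm jet set \<Rightarrow>
     ('m jet \<Rightarrow> real) \<Rightarrow> bool" where
  "first_integral F S W f \<longleftrightarrow> smooth_fn F W f \<and> form_eq F 0 W (lie S (fn F f)) 0"

section \<open>Lagrangian and conservative vector fields\<close>

definition poincare_cartan ::
  "('m::topological_space, 'n::finite) fibration \<Rightarrow> ('m jet \<Rightarrow> real) \<Rightarrow> ('m, 'n) jform" where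
  "poincare_cartan F L = fmult (fn F L) dt + d_J (fn F L)"

definition regular ::
  "('m::topological_space, 'n::finite) fibration \<Rightarrow> 'm jet set \<Rightarrow> ('m jet \<Rightarrow> real) \<Rightarrow> bool" where
  "regular F W L \<longleftrightarrow> has_rank F W (ext_d (poincare_cartan F L)) (2 * CARD('n))"

text \<open>\<open>L\<close>, defined on the open set \<open>W\<close>, is a regular Lagrangian whose Euler-Lagrange field is \<open>S\<close>.\<close>

definition lagrangian_for ::
  "('m::topological_space, 'n::finite) fibration \<Rightarrow> ('m, 'n) jvec \<Rightarrow> 'm jet set \<Rightarrow>
     ('m jet \<Rightarrow> real) \<Rightarrow> bool" where
  "lagrangian_for F S W L \<longleftrightarrow> smooth_fn F W L \<and> regular F W L \<and>
     form_eq F 1 W (lie S (poincare_cartan F L)) (ext_d (fn F L))"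

definition lagrangian_on ::
  "('m::topological_space, 'n::finite) fibration \<Rightarrow> ('m, 'n) jvec \<Rightarrow> 'm jet set \<Rightarrow> bool" where
  "lagrangian_on F S W \<longleftrightarrow> (\<exists>L. lagrangian_for F S W L)"

text \<open>The Lagrangian is only required to exist near each point of \<open>W\<close>.\<close>

definition locally_lagrangian_on ::
  "('m::topological_space, 'n::finite) fibration \<Rightarrow> ('m, 'n) jvec \<Rightarrow> 'm jet set \<Rightarrow> bool" where
  "locally_lagrangian_on F S W \<longleftrightarrow>
     (\<forall>p\<in>W. \<exists>V. jet_open F V \<and> p \<in> V \<and> V \<subseteq> W \<and> lagrangian_on F S V)"

definition equivalent ::
  "('m::topological_space, 'n::finite) fibration \<Rightarrow> ('m, 'n) jvec \<Rightarrow> 'm jet set \<Rightarrow>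
     ('m, 'n) jform \<Rightarrow> ('m, 'n) jform \<Rightarrow> bool" where
  "equivalent F S W \<theta>1 \<theta>2 \<longleftrightarrow>
     form_eq F 2 W (wedge1 \<theta>1 dt) (wedge1 \<theta>2 dt) \<and>
     form_eq F 0 W (lie S (contr S (\<theta>1 - \<theta>2))) 0"

text \<open>
  \<open>S\<close> is Lagrangian and some class \<open>[\<theta>\<^sub>L]\<close> contains a semi-basic \<open>1\<close>-form \<open>\<theta>\<close> that is not
  \<open>d\<^sub>J\<close>-closed.  The form \<open>\<theta>\<close> is defined on all of \<open>W\<close>, whereas \<open>L\<close> is only locally defined: the
  first integral \<open>f\<close> in \<open>\<theta> = \<theta>\<^sub>L + f dt\<close> is a primitive of \<open>-i\<^sub>S d\<theta>\<close>, which need not be exact.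
  Membership of \<open>\<theta>\<close> in \<open>\<Lambda>\<^sup>1\<^sub>S(W)\<close> is not imposed, as it is inherited from \<open>\<theta>\<^sub>L\<close>.
\<close>

definition conservative_lagrangian_on ::
  "('m::topological_space, 'n::finite) fibration \<Rightarrow> ('m, 'n) jvec \<Rightarrow> 'm jet set \<Rightarrow> bool" where
  "conservative_lagrangian_on F S W \<longleftrightarrow> locally_lagrangian_on F S W \<and>
     (\<exists>\<theta>. one_form F W \<theta> \<and> semi_basic F W \<theta> \<and> \<not> form_eq F 2 W (d_J \<theta>) 0 \<and>
        (\<forall>p\<in>W. \<exists>V L. jet_open F V \<and> p \<in> V \<and> V \<subseteq> W \<and> lagrangian_for F S V L \<and>
           equivalent F S V \<theta> (poincare_cartan F L)))"

end

theory Submission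
  imports Defs
begin

text \<open>
  Put \<open>\<beta> = i\<^sub>S d\<theta>\<close>, so that \<open>d\<beta>\<close> is the Lie derivative of \<open>d\<theta>\<close> along \<open>S\<close>.  Since \<open>[\<partial>/\<partial>y\<^sup>i, S]\<close> is
  \<open>\<partial>/\<partial>x\<^sup>i\<close> up to vertical vectors, Cartan's formula gives
  \<open>\<beta>(\<partial>/\<partial>y\<^sup>i) = \<theta>(\<partial>/\<partial>x\<^sup>i) - \<partial>(i\<^sub>S\<theta>)/\<partial>y\<^sup>i\<close> for semi-basic \<open>\<theta>\<close>.  It has three consequences.  A closed
  semi-basic form that annihilates \<open>S\<close> vanishes.  If \<open>d\<^sub>J\<theta> = 0\<close>, then \<open>\<beta>\<close> is semi-basic, which says
  that \<open>\<theta> = \<theta>\<^sub>L\<close> with \<open>L = i\<^sub>S\<theta>\<close>.  If only \<open>d\<beta> = 0\<close>, then locally \<open>\<beta> = -df\<close> with \<open>S(f) = 0\<close>, and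
  the formula says that \<open>\<theta> = \<theta>\<^sub>L + f dt\<close> with \<open>L = i\<^sub>S\<theta> - f\<close>.

  Conversely let \<open>\<theta> = \<theta>\<^sub>L + f dt\<close> with \<open>S(f) = 0\<close>.  Then \<open>\<beta> + df = i\<^sub>S d\<theta>\<^sub>L\<close> is semi-basic and
  annihilates \<open>S\<close>, so it is closed iff it vanishes.  Hence \<open>d\<beta> = 0\<close> iff \<open>L\<close> satisfies the
  Euler-Lagrange equation for \<open>S\<close>, and in that case \<open>d\<theta> + \<beta> \<and> dt = d\<theta>\<^sub>L\<close>, so that non-degeneracy of
  \<open>\<theta>\<close> is regularity of \<open>L\<close>.
\<close>

section \<open>Calculus of smooth maps\<close>

abbreviation fd :: "('a::real_normed_vector \<Rightarrow> 'b::real_normed_vector) \<Rightarrow> 'a \<Rightarrow> 'a \<Rightarrow> 'b" where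
  "fd f x \<equiv> frechet_derivative f (at x)"

lemma fd_unique: "(f has_derivative f') (at x) \<Longrightarrow> fd f x = f'"
  by (rule frechet_derivative_at[symmetric])

lemma has_derivative_fd: "f differentiable at x \<Longrightarrow> (f has_derivative fd f x) (at x)"
  by (simp add: frechet_derivative_works)

lemma linear_fd: "f differentiable at x \<Longrightarrow> linear (fd f x)"
  by (rule linear_frechet_derivative)

lemma has_derivative_cong_open:
  assumes "(f has_derivative f') (at x)" "open U" "x \<in> U" "\<And>y. y \<in> U \<Longrightarrow> f y = g y"
  shows "(g has_derivative f') (at x)"
  using assms by (rule has_derivative_transform_within_open)

lemma fd_cong_open:
  assumes "open U" "x \<in> U" "\<And>y. y \<in> U \<Longrightarrow> f y = g y"
  shows "fd f x = fd g x"
proof -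
  have "(f has_derivative f') (at x) \<longleftrightarrow> (g has_derivative f') (at x)" for f'
    using has_derivative_cong_open[of f f' x U g] has_derivative_cong_open[of g f' x U f] assms by auto
  then show ?thesis unfolding frechet_derivative_def by simp
qed

lemma differentiable_cong_open:
  assumes "f differentiable at x" "open U" "x \<in> U" "\<And>y. y \<in> U \<Longrightarrow> f y = g y"
  shows "g differentiable at x"
  using assms unfolding differentiable_def by (blast intro: has_derivative_cong_open)

section \<open>Stability of finite-order differentiability\<close>

lemma Ck_on_subset: "Ck_on k U f \<Longrightarrow> V \<subseteq> U \<Longrightarrow> Ck_on k V f"
  by (induction k arbitrary: f) (auto intro: continuous_on_subset)

lemma Ck_on_Suc_imp_Ck_on: "Ck_on (Suc k) U f \<Longrightarrow> Ck_on k U f"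
proof (induction k arbitrary: f)
  case 0
  then show ?case
    by (auto intro!: continuous_at_imp_continuous_on differentiable_imp_continuous_within)
next
  case (Suc k)
  have "Ck_on k U (\<lambda>x. fd f x v)" for v
  proof (rule Suc.IH)
    show "Ck_on (Suc k) U (\<lambda>x. fd f x v)" using Suc.prems unfolding Ck_on.simps(2)[of "Suc k"] by blast
  qed
  then show ?case using Suc.prems by simp
qed

text \<open>Openness of \<open>U\<close> is what lets pointwise agreement pass to derivatives:
  \<open>frechet_derivative\<close> at a point looks at a full neighbourhood, and
  \<open>Ck_on\<close> iterates it.\<close>

lemma Ck_on_cong:
  assumes "open U" "Ck_on k U f" "\<And>x. x \<in> U \<Longrightarrow> f x = g x"
  shows "Ck_on k U g"
  using assms(2,3)
proof (induction k arbitrary: f g)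
  case 0
  then show ?case using continuous_on_cong by fastforce
next
  case (Suc k)
  have "g differentiable at x" if "x \<in> U" for x
    using differentiable_cong_open[OF _ assms(1) that] Suc.prems that by auto
  moreover have "Ck_on k U (\<lambda>x. fd g x v)" for v
  proof (rule Suc.IH)
    show "Ck_on k U (\<lambda>x. fd f x v)" using Suc.prems by simp
    show "fd f x v = fd g x v" if "x \<in> U" for x
      using fd_cong_open[OF assms(1) that, of f g] Suc.prems(2) by simp
  qed
  ultimately show ?case by simp
qed

text \<open>Used where the neighbourhood depends on the point, as for a change of charts that has to
  be factored through an auxiliary atlas chart.\<close>

lemma Ck_on_local:
  assumes "\<And>x. x \<in> U \<Longrightarrow> \<exists>N. open N \<and> x \<in> N \<and> Ck_on k N f"
  shows "Ck_on k U f"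
  using assms
proof (induction k arbitrary: f)
  case 0
  have "isCont f x" if x: "x \<in> U" for x
  proof -
    obtain N where "open N" "x \<in> N" "continuous_on N f" using 0[OF x] by auto
    then show ?thesis by (simp add: continuous_on_eq_continuous_at)
  qed
  then show ?case by (simp add: continuous_at_imp_continuous_on)
next
  case (Suc k)
  have "f differentiable at x" if x: "x \<in> U" for x
    using Suc.prems[OF x] by auto
  moreover have "Ck_on k U (\<lambda>x. fd f x v)" for v
  proof (rule Suc.IH)
    fix x assume "x \<in> U"
    then show "\<exists>N. open N \<and> x \<in> N \<and> Ck_on k N (\<lambda>x. fd f x v)"
      using Suc.prems by fastforce
  qed
  ultimately show ?case by simp
qed

lemma Ck_on_const: "Ck_on k U (\<lambda>x. a)"
  by (induction k arbitrary: a) (auto simp: frechet_derivative_const)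

lemma Ck_on_bounded_linear_compose:
  assumes l: "bounded_linear l" and U: "open U" and f: "Ck_on k U f"
  shows "Ck_on k U (\<lambda>x. l (f x))"
  using f
proof (induction k arbitrary: f)
  case 0
  then show ?case using l by (simp add: bounded_linear.continuous_on)
next
  case (Suc k)
  have D: "((\<lambda>x. l (f x)) has_derivative (\<lambda>v. l (fd f x v))) (at x)" if "x \<in> U" for x
    using Suc.prems that by (auto intro!: bounded_linear.has_derivative[OF l] has_derivative_fd)
  have "Ck_on k U (\<lambda>x. fd (\<lambda>x. l (f x)) x v)" for v
  proof (rule Ck_on_cong[OF U])
    show "Ck_on k U (\<lambda>x. l (fd f x v))" using Suc by simp
  qed (simp add: fd_unique[OF D])
  with D show ?case by (auto simp: differentiable_def)
qed

lemma Ck_on_add: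
  assumes U: "open U" and f: "Ck_on k U f" and g: "Ck_on k U g"
  shows "Ck_on k U (\<lambda>x. f x + g x)"
  using f g
proof (induction k arbitrary: f g)
  case 0
  then show ?case by (simp add: continuous_on_add)
next
  case (Suc k)
  have D: "((\<lambda>x. f x + g x) has_derivative (\<lambda>v. fd f x v + fd g x v)) (at x)" if "x \<in> U" for x
    using Suc.prems that by (auto intro!: has_derivative_add has_derivative_fd)
  have "Ck_on k U (\<lambda>x. fd (\<lambda>x. f x + g x) x v)" for v
  proof (rule Ck_on_cong[OF U])
    show "Ck_on k U (\<lambda>x. fd f x v + fd g x v)" using Suc by simp
  qed (simp add: fd_unique[OF D])
  with D show ?case by (auto simp: differentiable_def)
qed

lemma Ck_on_scaleR:
  assumes U: "open U" and f: "Ck_on k U f" and g: "Ck_on k U g"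
  shows "Ck_on k U (\<lambda>x. f x *\<^sub>R g x)"
  using f g
proof (induction k arbitrary: f g)
  case 0
  then show ?case by (simp add: continuous_on_scaleR)
next
  case (Suc k)
  have D: "((\<lambda>x. f x *\<^sub>R g x) has_derivative (\<lambda>v. f x *\<^sub>R fd g x v + fd f x v *\<^sub>R g x)) (at x)"
    if "x \<in> U" for x
    using Suc.prems that by (auto intro!: has_derivative_scaleR has_derivative_fd)
  have "Ck_on k U (\<lambda>x. fd (\<lambda>x. f x *\<^sub>R g x) x v)" for v
  proof (rule Ck_on_cong[OF U])
    show "Ck_on k U (\<lambda>x. f x *\<^sub>R fd g x v + fd f x v *\<^sub>R g x)"
      using Suc Ck_on_Suc_imp_Ck_on[OF Suc.prems(1)] Ck_on_Suc_imp_Ck_on[OF Suc.prems(2)]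
      by (intro Ck_on_add U) simp_all
  qed (simp add: fd_unique[OF D])
  with D show ?case by (auto simp: differentiable_def)
qed

lemma Ck_on_sum:
  assumes "open U" "\<And>i. i \<in> I \<Longrightarrow> Ck_on k U (f i)"
  shows "Ck_on k U (\<lambda>x. \<Sum>i\<in>I. f i x)"
  using assms(2)
  by (induction I rule: infinite_finite_induct) (auto intro!: Ck_on_const Ck_on_add assms(1))

lemma linear_expand_scaleR:
  fixes f :: "'a::euclidean_space \<Rightarrow> 'b::real_vector"
  assumes "linear f"
  shows "f v = (\<Sum>b\<in>Basis. (v \<bullet> b) *\<^sub>R f b)"
proof -
  have "f v = f (\<Sum>b\<in>Basis. (v \<bullet> b) *\<^sub>R b)" by (simp add: euclidean_representation)
  also have "\<dots> = (\<Sum>b\<in>Basis. (v \<bullet> b) *\<^sub>R f b)"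
    by (simp only: linear_sum[OF assms] linear_cmul[OF assms])
  finally show ?thesis .
qed

text \<open>By the chain rule the derivative of \<open>g\<close> is applied to the moving vector
  \<open>fd f x v\<close>, whereas \<open>Ck_on\<close> controls fixed directions. Expansion in a
  basis of the Euclidean middle space gives a finite sum of products of functions of order
  \<open>k\<close>.\<close>

lemma Ck_on_compose:
  fixes f :: "'a::real_normed_vector \<Rightarrow> 'b::euclidean_space"
  assumes U: "open U" and V: "open V" and sub: "f ` U \<subseteq> V"
    and f: "Ck_on k U f" and g: "Ck_on k V g"
  shows "Ck_on k U (\<lambda>x. g (f x))"
  using f g
proof (induction k arbitrary: g)
  case 0
  then show ?case using sub by (auto intro: continuous_on_compose2)
next
  case (Suc k)
  have f': "f differentiable at x" if "x \<in> U" for x using Suc.prems(1) that by simp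
  have g': "g differentiable at (f x)" if "x \<in> U" for x using Suc.prems(2) sub that by auto
  have D: "((\<lambda>x. g (f x)) has_derivative (\<lambda>v. fd g (f x) (fd f x v))) (at x)" if "x \<in> U" for x
    using has_derivative_compose[OF has_derivative_fd[OF f'[OF that]] has_derivative_fd[OF g'[OF that]]] .
  have expand: "fd g (f x) w = (\<Sum>b\<in>Basis. (w \<bullet> b) *\<^sub>R fd g (f x) b)" if "x \<in> U" for x w
    by (rule linear_expand_scaleR[OF linear_fd[OF g'[OF that]]])
  have "Ck_on k U (\<lambda>x. fd (\<lambda>x. g (f x)) x v)" for v
  proof (rule Ck_on_cong[OF U])
    show "Ck_on k U (\<lambda>x. \<Sum>b\<in>Basis. (fd f x v \<bullet> b) *\<^sub>R fd g (f x) b)"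
    proof (intro Ck_on_sum Ck_on_scaleR U)
      fix b :: 'b
      show "Ck_on k U (\<lambda>x. fd f x v \<bullet> b)"
        using Suc.prems(1) by (intro Ck_on_bounded_linear_compose[OF bounded_linear_inner_left U]) simp
      show "Ck_on k U (\<lambda>x. fd g (f x) b)"
        using Suc.prems Ck_on_Suc_imp_Ck_on[OF Suc.prems(1)] by (intro Suc.IH) simp_all
    qed
    show "(\<Sum>b\<in>Basis. (fd f x v \<bullet> b) *\<^sub>R fd g (f x) b) = fd (\<lambda>x. g (f x)) x v" if "x \<in> U" for x
      unfolding fd_unique[OF D[OF that]] expand[OF that, of "fd f x v"] ..
  qed
  with D show ?case by (auto simp: differentiable_def)
qed

section \<open>Stability of smoothness\<close>

lemma smooth_on_subset: "smooth_on U f \<Longrightarrow> V \<subseteq> U \<Longrightarrow> smooth_on V f"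
  unfolding smooth_on_def using Ck_on_subset by blast

lemma smooth_on_cong: "open U \<Longrightarrow> smooth_on U f \<Longrightarrow> (\<And>x. x \<in> U \<Longrightarrow> f x = g x) \<Longrightarrow> smooth_on U g"
  unfolding smooth_on_def using Ck_on_cong by blast

lemma smooth_on_local:
  "(\<And>x. x \<in> U \<Longrightarrow> \<exists>N. open N \<and> x \<in> N \<and> smooth_on N f) \<Longrightarrow> smooth_on U f"
  unfolding smooth_on_def by (meson Ck_on_local)

lemma smooth_on_const: "smooth_on U (\<lambda>x. a)"
  unfolding smooth_on_def by (simp add: Ck_on_const)

lemma smooth_on_bounded_linear_compose:
  "bounded_linear l \<Longrightarrow> open U \<Longrightarrow> smooth_on U f \<Longrightarrow> smooth_on U (\<lambda>x. l (f x))"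
  unfolding smooth_on_def by (simp add: Ck_on_bounded_linear_compose)

lemma smooth_on_add: "open U \<Longrightarrow> smooth_on U f \<Longrightarrow> smooth_on U g \<Longrightarrow> smooth_on U (\<lambda>x. f x + g x)"
  unfolding smooth_on_def by (simp add: Ck_on_add)

lemma smooth_on_uminus: "open U \<Longrightarrow> smooth_on U f \<Longrightarrow> smooth_on U (\<lambda>x. - f x)"
  by (rule smooth_on_bounded_linear_compose[OF bounded_linear_minus[OF bounded_linear_ident]])

lemma smooth_on_diff:
  "open U \<Longrightarrow> smooth_on U f \<Longrightarrow> smooth_on U g \<Longrightarrow> smooth_on U (\<lambda>x. f x - g x)"
  using smooth_on_add[of U f "\<lambda>x. - g x"] smooth_on_uminus[of U g] by simp

lemma smooth_on_scaleR:
  "open U \<Longrightarrow> smooth_on U f \<Longrightarrow> smooth_on U g \<Longrightarrow> smooth_on U (\<lambda>x. f x *\<^sub>R g x)"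
  unfolding smooth_on_def by (simp add: Ck_on_scaleR)

lemma smooth_on_mult:
  fixes f :: "'a::real_normed_vector \<Rightarrow> real"
  shows "open U \<Longrightarrow> smooth_on U f \<Longrightarrow> smooth_on U g \<Longrightarrow> smooth_on U (\<lambda>x. f x * g x)"
  using smooth_on_scaleR[of U f g] by simp

lemma smooth_on_sum:
  "open U \<Longrightarrow> (\<And>i. i \<in> I \<Longrightarrow> smooth_on U (f i)) \<Longrightarrow> smooth_on U (\<lambda>x. \<Sum>i\<in>I. f i x)"
  unfolding smooth_on_def by (simp add: Ck_on_sum)

lemma smooth_on_compose:
  fixes f :: "'a::real_normed_vector \<Rightarrow> 'b::euclidean_space"
  shows "open U \<Longrightarrow> open V \<Longrightarrow> f ` U \<subseteq> V \<Longrightarrow> smooth_on U f \<Longrightarrow> smooth_on V g \<Longrightarrow>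
    smooth_on U (\<lambda>x. g (f x))"
  unfolding smooth_on_def using Ck_on_compose[of U V f _ g] by blast

lemma smooth_on_bounded_linear: "bounded_linear l \<Longrightarrow> smooth_on U l"
proof -
  assume l: "bounded_linear l"
  have "Ck_on k U l" for k
  proof (cases k)
    case 0
    then show ?thesis using l by (simp add: linear_continuous_on)
  next
    case (Suc m)
    have "fd l x = l" for x
      by (rule fd_unique) (rule bounded_linear_imp_has_derivative[OF l])
    then show ?thesis using Suc l by (auto simp: bounded_linear_imp_differentiable Ck_on_const)
  qed
  then show ?thesis by (simp add: smooth_on_def)
qed

lemma smooth_on_imp_differentiable: "smooth_on U f \<Longrightarrow> x \<in> U \<Longrightarrow> f differentiable at x"
  unfolding smooth_on_def by (drule spec[of _ "Suc 0"]) simp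

lemma smooth_on_fd: "smooth_on U f \<Longrightarrow> smooth_on U (\<lambda>x. fd f x v)"
  unfolding smooth_on_def
proof
  fix k assume "\<forall>k. Ck_on k U f"
  then have "Ck_on (Suc k) U f" ..
  then show "Ck_on k U (\<lambda>x. fd f x v)" by simp
qed

lemma smooth_on_imp_continuous_on: "smooth_on U f \<Longrightarrow> continuous_on U f"
  unfolding smooth_on_def by (drule spec[of _ 0]) simp

lemma smooth_on_has_derivative: "smooth_on U f \<Longrightarrow> x \<in> U \<Longrightarrow> (f has_derivative fd f x) (at x)"
  by (simp add: has_derivative_fd smooth_on_imp_differentiable)

lemma smooth_on_linear_fd: "smooth_on U f \<Longrightarrow> x \<in> U \<Longrightarrow> linear (fd f x)"
  by (simp add: linear_fd smooth_on_imp_differentiable)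

text \<open>The same basis expansion as for compositions, now for the derivative of \<open>f\<close>
  along a vector field over \<open>q\<close>. The \<open>y\<close>-component of a change of induced
  coordinates has this shape.\<close>

lemma smooth_on_fd_apply:
  fixes q :: "'a::real_normed_vector \<Rightarrow> 'b::euclidean_space"
  assumes U: "open U" and V: "open V" and sub: "q ` U \<subseteq> V"
    and q: "smooth_on U q" and f: "smooth_on V f" and X: "smooth_on U X"
  shows "smooth_on U (\<lambda>x. fd f (q x) (X x))"
proof (rule smooth_on_cong[OF U])
  show "smooth_on U (\<lambda>x. \<Sum>b\<in>Basis. (X x \<bullet> b) *\<^sub>R fd f (q x) b)"
    by (intro smooth_on_sum smooth_on_scaleR U smooth_on_compose[OF U V sub q smooth_on_fd[OF f]]
        smooth_on_bounded_linear_compose[OF bounded_linear_inner_left U X])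
  show "(\<Sum>b\<in>Basis. (X x \<bullet> b) *\<^sub>R fd f (q x) b) = fd f (q x) (X x)" if "x \<in> U" for x
    using that sub by (intro linear_expand_scaleR[symmetric] smooth_on_linear_fd[OF f]) blast
qed

lemma smooth_on_Pair:
  fixes f :: "'a::real_normed_vector \<Rightarrow> 'b::real_normed_vector" and g :: "'a \<Rightarrow> 'c::real_normed_vector"
  assumes U: "open U" and f: "smooth_on U f" and g: "smooth_on U g"
  shows "smooth_on U (\<lambda>x. (f x, g x))"
proof -
  have "bounded_linear (\<lambda>u::'b. (u, 0::'c))" "bounded_linear (\<lambda>u::'c. (0::'b, u))"
    by (auto intro!: bounded_linear_Pair bounded_linear_ident bounded_linear_zero)
  from smooth_on_add[OF U smooth_on_bounded_linear_compose[OF this(1) U f]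
      smooth_on_bounded_linear_compose[OF this(2) U g]]
  have "smooth_on U (\<lambda>x. (f x, 0) + (0, g x))" .
  then show ?thesis by simp
qed

section \<open>Symmetry of second derivatives\<close>

text \<open>Both orders of differentiation are read off the same second difference.\<close>

lemma second_difference_mvt:
  fixes g :: "'a::real_normed_vector \<Rightarrow> real"
  assumes g: "smooth_on (ball x d) g" and h: "h > 0" "h * (norm v + norm w) < d"
  shows "\<exists>p\<in>ball x d. g (x + h *\<^sub>R v + h *\<^sub>R w) - g (x + h *\<^sub>R v) - g (x + h *\<^sub>R w) + g x
    = h\<^sup>2 * fd (\<lambda>z. fd g z v) p w"
proof -
  have inb: "x + s *\<^sub>R v + t *\<^sub>R w \<in> ball x d" if "0 \<le> s" "s \<le> h" "0 \<le> t" "t \<le> h" for s t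
  proof -
    have "norm (s *\<^sub>R v + t *\<^sub>R w) \<le> s * norm v + t * norm w"
      using that by (intro order_trans[OF norm_triangle_ineq]) simp
    also have "\<dots> \<le> h * norm v + h * norm w" using that by (intro add_mono mult_right_mono) auto
    finally have "norm (s *\<^sub>R v + t *\<^sub>R w) < d" using h by (simp add: algebra_simps)
    moreover have "dist x (x + s *\<^sub>R v + t *\<^sub>R w) = norm (s *\<^sub>R v + t *\<^sub>R w)"
      by (simp add: dist_norm add.assoc norm_minus_cancel[of "s *\<^sub>R v + t *\<^sub>R w", symmetric] del: norm_minus_cancel)
    ultimately show ?thesis by simp
  qed
  have der: "((\<lambda>s. k (a + s *\<^sub>R u)) has_field_derivative fd k (a + s *\<^sub>R u) u) (at s)"
    if k: "smooth_on (ball x d) k" and a: "a + s *\<^sub>R u \<in> ball x d"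
    for k :: "'a \<Rightarrow> real" and a u s
  proof -
    have lin: "linear (fd k (a + s *\<^sub>R u))" using smooth_on_linear_fd[OF k a] .
    have "((\<lambda>s. a + s *\<^sub>R u) has_derivative (\<lambda>r. r *\<^sub>R u)) (at s)"
      by (auto intro!: derivative_eq_intros)
    from has_derivative_compose[OF this smooth_on_has_derivative[OF k a]]
    have "((\<lambda>s. k (a + s *\<^sub>R u)) has_derivative (\<lambda>r. r * fd k (a + s *\<^sub>R u) u)) (at s)"
      using linear_cmul[OF lin] by simp
    then show ?thesis by (rule has_derivative_imp_has_field_derivative) simp
  qed
  \<comment> \<open>The first difference in the direction \<open>w\<close>, as a function of the
    step along \<open>v\<close>. The mean value theorem for \<open>?q\<close> produces a derivative
    along \<open>v\<close>; applied to \<open>?r\<close> below, it produces the second one along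
    \<open>w\<close>.\<close>
  let ?q = "\<lambda>s. g ((x + h *\<^sub>R w) + s *\<^sub>R v) - g (x + s *\<^sub>R v)"
  have "\<exists>s. 0 < s \<and> s < h \<and> ?q h - ?q 0 = (h - 0) *
      (fd g ((x + h *\<^sub>R w) + s *\<^sub>R v) v - fd g (x + s *\<^sub>R v) v)"
  proof (rule MVT2[OF h(1)])
    fix s assume "0 \<le> s" "s \<le> h"
    then show "(?q has_real_derivative fd g (x + h *\<^sub>R w + s *\<^sub>R v) v - fd g (x + s *\<^sub>R v) v) (at s)"
      using inb[of s h] inb[of s 0] h(1)
      by (intro DERIV_diff der g) (auto simp: algebra_simps)
  qed
  then obtain s where s: "0 < s" "s < h"
    and 1: "?q h - ?q 0 = h * (fd g ((x + h *\<^sub>R w) + s *\<^sub>R v) v - fd g (x + s *\<^sub>R v) v)"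
    by auto
  let ?r = "\<lambda>t. fd g (x + s *\<^sub>R v + t *\<^sub>R w) v"
  have "\<exists>t. 0 < t \<and> t < h \<and> ?r h - ?r 0 = (h - 0) * fd (\<lambda>z. fd g z v) (x + s *\<^sub>R v + t *\<^sub>R w) w"
  proof (rule MVT2[OF h(1)])
    fix t assume "0 \<le> t" "t \<le> h"
    then show "(?r has_real_derivative fd (\<lambda>z. fd g z v) (x + s *\<^sub>R v + t *\<^sub>R w) w) (at t)"
      using inb[of s t] s by (intro der smooth_on_fd g) auto
  qed
  then obtain t where t: "0 < t" "t < h"
    and 2: "?r h - ?r 0 = h * fd (\<lambda>z. fd g z v) (x + s *\<^sub>R v + t *\<^sub>R w) w"
    by auto
  have "?q h - ?q 0 = h * (?r h - ?r 0)" using 1 by (simp add: algebra_simps)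
  also have "\<dots> = h\<^sup>2 * fd (\<lambda>z. fd g z v) (x + s *\<^sub>R v + t *\<^sub>R w) w" unfolding 2 by (simp add: power2_eq_square)
  finally have "?q h - ?q 0 = h\<^sup>2 * fd (\<lambda>z. fd g z v) (x + s *\<^sub>R v + t *\<^sub>R w) w" .
  moreover have "?q h - ?q 0 = g (x + h *\<^sub>R v + h *\<^sub>R w) - g (x + h *\<^sub>R v) - g (x + h *\<^sub>R w) + g x"
    by (simp add: algebra_simps)
  ultimately show ?thesis using inb[of s t] s t by (intro bexI[of _ "x + s *\<^sub>R v + t *\<^sub>R w"]) auto
qed

lemma symmetric_second_derivative:
  fixes g :: "'a::real_normed_vector \<Rightarrow> real"
  assumes U: "open U" "x \<in> U" and g: "smooth_on U g"
  shows "fd (\<lambda>z. fd g z v) x w = fd (\<lambda>z. fd g z w) x v"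
proof (rule ccontr)
  let ?A = "\<lambda>z. fd (\<lambda>z. fd g z v) z w" and ?B = "\<lambda>z. fd (\<lambda>z. fd g z w) z v"
  assume ne: "?A x \<noteq> ?B x"
  \<comment> \<open>Half the gap: one number cannot lie within \<open>e\<close> both of
    \<open>?A x\<close> and of \<open>?B x\<close>.\<close>
  define e where "e = \<bar>?A x - ?B x\<bar> / 2"
  have e: "e > 0" using ne by (simp add: e_def)
  have cont: "isCont ?A x" "isCont ?B x"
    using smooth_on_imp_continuous_on[OF smooth_on_fd[OF smooth_on_fd[OF g]]] U
    by (simp_all add: continuous_on_eq_continuous_at)
  obtain d1 where d1: "d1 > 0" "\<And>z. dist z x < d1 \<Longrightarrow> dist (?A z) (?A x) < e"
    using cont(1) e unfolding continuous_at_eps_delta by blast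
  obtain d2 where d2: "d2 > 0" "\<And>z. dist z x < d2 \<Longrightarrow> dist (?B z) (?B x) < e"
    using cont(2) e unfolding continuous_at_eps_delta by blast
  obtain d3 where d3: "d3 > 0" "ball x d3 \<subseteq> U" using U openE by blast
  define d where "d = min d1 (min d2 d3)"
  have d: "d > 0" "d \<le> d1" "d \<le> d2" "ball x d \<subseteq> U" using d1 d2 d3 by (auto simp: d_def)
  \<comment> \<open>The summand 1 keeps the denominator positive when both vectors vanish and makes
    \<open>h * (norm v + norm w) < d\<close> strict.\<close>
  define h where "h = d / (2 * (norm v + norm w + 1))"
  have n: "norm v + norm w + 1 > 0"
    using norm_ge_zero[of v] norm_ge_zero[of w] by argo
  have h: "h > 0" using d n by (simp add: h_def)
  have "h * (norm v + norm w) < h * (2 * (norm v + norm w + 1))"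
    using n by (intro mult_strict_left_mono h) argo
  also have "\<dots> = d" using n by (simp add: h_def)
  finally have hd: "h * (norm v + norm w) < d" .
  have gb: "smooth_on (ball x d) g" using smooth_on_subset g d by blast
  obtain p where p: "p \<in> ball x d"
    "g (x + h *\<^sub>R v + h *\<^sub>R w) - g (x + h *\<^sub>R v) - g (x + h *\<^sub>R w) + g x = h\<^sup>2 * ?A p"
    using second_difference_mvt[OF gb h hd] by blast
  have hd': "h * (norm w + norm v) < d" using hd by (simp add: add.commute)
  obtain q where q: "q \<in> ball x d"
    "g (x + h *\<^sub>R w + h *\<^sub>R v) - g (x + h *\<^sub>R w) - g (x + h *\<^sub>R v) + g x = h\<^sup>2 * ?B q"
    using second_difference_mvt[OF gb h hd'] by blast
  have "h\<^sup>2 * ?A p = h\<^sup>2 * ?B q" using p(2) q(2) by (simp add: algebra_simps)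
  then have eq: "?A p = ?B q" using h by simp
  have "dist (?A p) (?A x) < e" "dist (?B q) (?B x) < e"
    using d1(2)[of p] d2(2)[of q] p(1) q(1) d by (auto simp: dist_commute)
  moreover have "False" if "\<bar>a - b\<bar> < \<bar>b - c\<bar> / 2" "\<bar>a - c\<bar> < \<bar>b - c\<bar> / 2" for a b c :: real
    using that by argo
  ultimately show False using eq unfolding e_def dist_real_def by metis
qed

section \<open>One-forms on open sets of a Euclidean space\<close>

text \<open>The curried form of \<open>one_form\<close> in one chart, free of argument lists.
  Smoothness is asked for along each fixed vector; linearity and a finite basis extend it to smooth
  vector fields.\<close>

definition one_form_on :: "'a::euclidean_space set \<Rightarrow> ('a \<Rightarrow> 'a \<Rightarrow> real) \<Rightarrow> bool" where
  "one_form_on U \<alpha> \<longleftrightarrow> (\<forall>x\<in>U. linear (\<alpha> x)) \<and> (\<forall>v. smooth_on U (\<lambda>x. \<alpha> x v))"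

definition ext_d1 :: "('a::euclidean_space \<Rightarrow> 'a \<Rightarrow> real) \<Rightarrow> 'a \<Rightarrow> 'a \<Rightarrow> 'a \<Rightarrow> real" where
  "ext_d1 \<alpha> x v w = fd (\<lambda>z. \<alpha> z w) x v - fd (\<lambda>z. \<alpha> z v) x w"

lemma linear_expand:
  fixes f :: "'a::euclidean_space \<Rightarrow> real"
  assumes "linear f"
  shows "f v = (\<Sum>b\<in>Basis. (v \<bullet> b) * f b)"
  using linear_expand_scaleR[OF assms, of v] by simp

lemma one_form_on_linear: "one_form_on U \<alpha> \<Longrightarrow> x \<in> U \<Longrightarrow> linear (\<alpha> x)"
  by (simp add: one_form_on_def)

lemma one_form_on_smooth: "one_form_on U \<alpha> \<Longrightarrow> smooth_on U (\<lambda>x. \<alpha> x v)"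
  by (simp add: one_form_on_def)

lemma one_form_on_cong:
  assumes "open U" "one_form_on U \<alpha>" "\<And>x v. x \<in> U \<Longrightarrow> \<alpha> x v = \<beta> x v"
  shows "one_form_on U \<beta>"
proof -
  have "\<alpha> x = \<beta> x" if "x \<in> U" for x using assms(3) that by auto
  moreover have "smooth_on U (\<lambda>x. \<beta> x v)" for v
    by (rule smooth_on_cong[OF assms(1), of "\<lambda>x. \<alpha> x v"]) (use assms in \<open>auto simp: one_form_on_def\<close>)
  ultimately show ?thesis using assms(2) by (simp add: one_form_on_def)
qed

lemma one_form_on_add:
  "open U \<Longrightarrow> one_form_on U \<alpha> \<Longrightarrow> one_form_on U \<beta> \<Longrightarrow> one_form_on U (\<lambda>x v. \<alpha> x v + \<beta> x v)"
  unfolding one_form_on_def by (auto intro: smooth_on_add linear_compose_add)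

lemma ext_d1_cong_open:
  assumes "open U" "x \<in> U" "\<And>x v. x \<in> U \<Longrightarrow> \<alpha> x v = \<beta> x v"
  shows "ext_d1 \<alpha> x v w = ext_d1 \<beta> x v w"
proof -
  have "fd (\<lambda>z. \<alpha> z u) x = fd (\<lambda>z. \<beta> z u) x" for u
    by (rule fd_cong_open[OF assms(1,2)]) (rule assms(3))
  then show ?thesis by (simp add: ext_d1_def)
qed

lemma ext_d1_add:
  assumes "one_form_on U \<alpha>" "one_form_on U \<beta>" "x \<in> U"
  shows "ext_d1 (\<lambda>x v. \<alpha> x v + \<beta> x v) x v w = ext_d1 \<alpha> x v w + ext_d1 \<beta> x v w"
proof -
  have "fd (\<lambda>z. \<alpha> z u + \<beta> z u) x = (\<lambda>v. fd (\<lambda>z. \<alpha> z u) x v + fd (\<lambda>z. \<beta> z u) x v)" for u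
    by (intro fd_unique has_derivative_add
        smooth_on_has_derivative[OF one_form_on_smooth[OF assms(1)] assms(3)]
        smooth_on_has_derivative[OF one_form_on_smooth[OF assms(2)] assms(3)])
  then show ?thesis by (simp add: ext_d1_def)
qed

text \<open>Linearity in \<open>w\<close> holds at every point near \<open>x\<close>, hence survives
  differentiation in the base point.\<close>

lemma fd_one_form_expand:
  assumes U: "open U" "x \<in> U" and \<alpha>: "one_form_on U \<alpha>"
  shows "fd (\<lambda>z. \<alpha> z w) x v = (\<Sum>b\<in>Basis. (w \<bullet> b) * fd (\<lambda>z. \<alpha> z b) x v)"
proof -
  have "((\<lambda>z. \<Sum>b\<in>Basis. (w \<bullet> b) * \<alpha> z b) has_derivative
      (\<lambda>v. \<Sum>b\<in>Basis. (w \<bullet> b) * fd (\<lambda>z. \<alpha> z b) x v)) (at x)"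
    by (intro has_derivative_sum has_derivative_mult_right
        smooth_on_has_derivative[OF one_form_on_smooth[OF \<alpha>] U(2)])
  moreover have "(\<Sum>b\<in>Basis. (w \<bullet> b) * \<alpha> z b) = \<alpha> z w" if "z \<in> U" for z
    by (rule linear_expand[OF one_form_on_linear[OF \<alpha> that], symmetric])
  ultimately have "((\<lambda>z. \<alpha> z w) has_derivative (\<lambda>v. \<Sum>b\<in>Basis. (w \<bullet> b) * fd (\<lambda>z. \<alpha> z b) x v)) (at x)"
    using has_derivative_cong_open[OF _ U, of "\<lambda>z. \<Sum>b\<in>Basis. (w \<bullet> b) * \<alpha> z b" _ "\<lambda>z. \<alpha> z w"] by simp
  then show ?thesis by (simp add: fd_unique)
qed

lemma linear_fd_one_form:
  assumes "open U" "x \<in> U" "one_form_on U \<alpha>"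
  shows "linear (\<lambda>w. fd (\<lambda>z. \<alpha> z w) x v)"
proof -
  have "(\<lambda>w. fd (\<lambda>z. \<alpha> z w) x v) = (\<lambda>w. \<Sum>b\<in>Basis. (w \<bullet> b) * fd (\<lambda>z. \<alpha> z b) x v)"
    by (rule ext) (rule fd_one_form_expand[OF assms])
  moreover have "linear (\<lambda>w. \<Sum>b\<in>Basis. (w \<bullet> b) * fd (\<lambda>z. \<alpha> z b) x v)"
    by (rule linearI) (simp_all add: algebra_simps sum.distrib sum_distrib_left)
  ultimately show ?thesis by simp
qed

section \<open>The Leibniz rule and Cartan's formula\<close>

lemma smooth_on_one_form_apply:
  assumes U: "open U" and \<alpha>: "one_form_on U \<alpha>" and X: "smooth_on U X"
  shows "smooth_on U (\<lambda>x. \<alpha> x (X x))"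
proof (rule smooth_on_cong[OF U])
  show "smooth_on U (\<lambda>x. \<Sum>b\<in>Basis. (X x \<bullet> b) * \<alpha> x b)"
    by (intro smooth_on_sum smooth_on_mult U one_form_on_smooth[OF \<alpha>]
        smooth_on_bounded_linear_compose[OF bounded_linear_inner_left U X])
  show "(\<Sum>b\<in>Basis. (X x \<bullet> b) * \<alpha> x b) = \<alpha> x (X x)" if "x \<in> U" for x
    by (rule linear_expand[OF one_form_on_linear[OF \<alpha> that], symmetric])
qed

lemma has_derivative_one_form_apply:
  assumes U: "open U" "x \<in> U" and \<alpha>: "one_form_on U \<alpha>" and X: "(X has_derivative X') (at x)"
  shows "((\<lambda>z. \<alpha> z (X z)) has_derivative (\<lambda>v. fd (\<lambda>z. \<alpha> z (X x)) x v + \<alpha> x (X' v))) (at x)"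
proof -
  have "((\<lambda>z. \<Sum>b\<in>Basis. (X z \<bullet> b) * \<alpha> z b) has_derivative
      (\<lambda>v. \<Sum>b\<in>Basis. (X x \<bullet> b) * fd (\<lambda>z. \<alpha> z b) x v + (X' v \<bullet> b) * \<alpha> x b)) (at x)"
    by (intro has_derivative_sum has_derivative_mult has_derivative_inner_left X
        smooth_on_has_derivative[OF one_form_on_smooth[OF \<alpha>] U(2)])
  moreover have "(\<Sum>b\<in>Basis. (X z \<bullet> b) * \<alpha> z b) = \<alpha> z (X z)" if "z \<in> U" for z
    by (rule linear_expand[OF one_form_on_linear[OF \<alpha> that], symmetric])
  moreover have "(\<Sum>b\<in>Basis. (X x \<bullet> b) * fd (\<lambda>z. \<alpha> z b) x v + (X' v \<bullet> b) * \<alpha> x b) =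
      fd (\<lambda>z. \<alpha> z (X x)) x v + \<alpha> x (X' v)" for v
    unfolding sum.distrib fd_one_form_expand[OF U \<alpha>, of "X x" v, symmetric]
      linear_expand[OF one_form_on_linear[OF \<alpha> U(2)], of "X' v", symmetric] ..
  ultimately show ?thesis
    using has_derivative_cong_open[OF _ U, of "\<lambda>z. \<Sum>b\<in>Basis. (X z \<bullet> b) * \<alpha> z b" _ "\<lambda>z. \<alpha> z (X z)"] by simp
qed

lemma fd_one_form_apply:
  assumes "open U" "x \<in> U" "one_form_on U \<alpha>" "smooth_on U X"
  shows "fd (\<lambda>z. \<alpha> z (X z)) x v = fd (\<lambda>z. \<alpha> z (X x)) x v + \<alpha> x (fd X x v)"
  using fd_unique[OF has_derivative_one_form_apply[OF assms(1-3)
        smooth_on_has_derivative[OF assms(4,2)]]] by simp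

lemma one_form_on_fd: "smooth_on U g \<Longrightarrow> one_form_on U (fd g)"
  by (simp add: one_form_on_def smooth_on_linear_fd smooth_on_fd)

lemma ext_d1_fd: "open U \<Longrightarrow> x \<in> U \<Longrightarrow> smooth_on U g \<Longrightarrow> ext_d1 (fd g) x v w = 0"
  by (simp add: ext_d1_def symmetric_second_derivative)

lemma ext_d1_skew: "ext_d1 \<alpha> x v w = - ext_d1 \<alpha> x w v"
  by (simp add: ext_d1_def)

lemma one_form_on_ext_d1:
  assumes U: "open U" and \<alpha>: "one_form_on U \<alpha>"
  shows "one_form_on U (\<lambda>x v. ext_d1 \<alpha> x v w)"
  unfolding one_form_on_def ext_d1_def
  using linear_fd_one_form[OF U _ \<alpha>] smooth_on_linear_fd[OF one_form_on_smooth[OF \<alpha>]]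
  by (auto intro!: linear_compose_sub smooth_on_diff[OF U] smooth_on_fd one_form_on_smooth[OF \<alpha>])

lemma one_form_on_contr_ext_d1:
  assumes U: "open U" and \<alpha>: "one_form_on U \<alpha>" and X: "smooth_on U X"
  shows "one_form_on U (\<lambda>x. ext_d1 \<alpha> x (X x))"
  unfolding one_form_on_def
proof (intro conjI ballI allI)
  fix x assume x: "x \<in> U"
  have "linear (\<lambda>v. - ext_d1 \<alpha> x v (X x))"
    using one_form_on_linear[OF one_form_on_ext_d1[OF U \<alpha>] x] by (rule linear_compose_neg)
  then show "linear (ext_d1 \<alpha> x (X x))" by (simp add: ext_d1_def[abs_def])
next
  fix v
  show "smooth_on U (\<lambda>x. ext_d1 \<alpha> x (X x) v)"
    by (rule smooth_on_one_form_apply[OF U one_form_on_ext_d1[OF U \<alpha>] X])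
qed

text \<open>This is d d = 0 on constant vectors: the six second derivatives cancel in pairs by
  symmetry.\<close>

lemma cyclic_sum_ext_d1:
  assumes U: "open U" "x \<in> U" and \<alpha>: "one_form_on U \<alpha>"
  shows "fd (\<lambda>z. ext_d1 \<alpha> z v w) x u + fd (\<lambda>z. ext_d1 \<alpha> z w u) x v + fd (\<lambda>z. ext_d1 \<alpha> z u v) x w = 0"
proof -
  have *: "fd (\<lambda>z. ext_d1 \<alpha> z a b) x c =
      fd (\<lambda>z. fd (\<lambda>z. \<alpha> z b) z a) x c - fd (\<lambda>z. fd (\<lambda>z. \<alpha> z a) z b) x c" for a b c
    unfolding ext_d1_def
    by (subst fd_unique[OF has_derivative_diff[OF
            smooth_on_has_derivative[OF smooth_on_fd[OF one_form_on_smooth[OF \<alpha>]] U(2)]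
            smooth_on_has_derivative[OF smooth_on_fd[OF one_form_on_smooth[OF \<alpha>]] U(2)]]]) simp
  note sym = symmetric_second_derivative[OF U one_form_on_smooth[OF \<alpha>]]
  show ?thesis
    unfolding *[of v w u] *[of w u v] *[of u v w] sym[of w v u] sym[of u w v] sym[of v u w] by simp
qed

text \<open>The left side is the Lie derivative in coordinates, and the identity is Cartan's
  formula: the Leibniz rule for \<alpha>(X) supplies the term with the derivative of
  \<open>X\<close>.\<close>

lemma cartan_one_form:
  assumes U: "open U" "x \<in> U" and \<alpha>: "one_form_on U \<alpha>" and X: "smooth_on U X"
  shows "fd (\<lambda>z. \<alpha> z w) x (X x) + \<alpha> x (fd X x w) = ext_d1 \<alpha> x (X x) w + fd (\<lambda>z. \<alpha> z (X z)) x w"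
  unfolding fd_one_form_apply[OF assms] ext_d1_def by simp

text \<open>Cartan's formula for the closed form d\<alpha>, with the coordinate Lie derivative on
  the left. The Leibniz rule accounts for the derivatives of \<open>X\<close>; what remains has
  \<open>X x\<close> frozen and is the cyclic identity.\<close>

lemma cartan_ext_d1:
  assumes U: "open U" "x \<in> U" and \<alpha>: "one_form_on U \<alpha>" and X: "smooth_on U X"
  shows "fd (\<lambda>z. ext_d1 \<alpha> z v w) x (X x) + ext_d1 \<alpha> x (fd X x v) w + ext_d1 \<alpha> x v (fd X x w) =
    ext_d1 (\<lambda>x. ext_d1 \<alpha> x (X x)) x v w"
proof -
  have "fd (\<lambda>z. ext_d1 \<alpha> z (X z) b) x a = fd (\<lambda>z. ext_d1 \<alpha> z (X x) b) x a + ext_d1 \<alpha> x (fd X x a) b"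
    for a b
    by (rule fd_one_form_apply[OF U one_form_on_ext_d1[OF U(1) \<alpha>] X])
  moreover have "fd (\<lambda>z. ext_d1 \<alpha> z w (X x)) x v = - fd (\<lambda>z. ext_d1 \<alpha> z (X x) w) x v"
    unfolding ext_d1_skew[of \<alpha> _ w "X x"]
    using fd_unique[OF has_derivative_minus[OF smooth_on_has_derivative[OF
          one_form_on_smooth[OF one_form_on_ext_d1[OF U(1) \<alpha>], of "X x" w] U(2)]]] by simp
  ultimately show ?thesis
    using cyclic_sum_ext_d1[OF U \<alpha>, of v w "X x"] ext_d1_skew[of \<alpha> x "fd X x w" v]
    unfolding ext_d1_def[of "\<lambda>x. ext_d1 \<alpha> x (X x)"] by simp
qed

section \<open>The Poincare lemma on balls\<close>

lemma smooth_on_from_derivative: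
  assumes "\<And>x. x \<in> U \<Longrightarrow> (g has_derivative \<beta> x) (at x)" "\<And>v. smooth_on U (\<lambda>x. \<beta> x v)" "open U"
  shows "smooth_on U g"
proof -
  have "Ck_on (Suc k) U g" for k
  proof -
    have "fd g x = \<beta> x" if "x \<in> U" for x using fd_unique assms(1) that by blast
    then have "Ck_on k U (\<lambda>x. fd g x v)" for v
      using assms(2)[of v] Ck_on_cong[OF assms(3), of k "\<lambda>x. \<beta> x v"] by (simp add: smooth_on_def)
    then show ?thesis using assms(1) by (auto simp: differentiable_def)
  qed
  then show ?thesis unfolding smooth_on_def using Ck_on_Suc_imp_Ck_on by blast
qed

text \<open>The primitive is the integral of the form along radial segments.\<close>

lemma poincare_lemma_ball:
  fixes \<beta> :: "'a::euclidean_space \<Rightarrow> 'a \<Rightarrow> real"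
  assumes \<beta>: "one_form_on (ball x0 r) \<beta>"
    and closed: "\<And>x v w. x \<in> ball x0 r \<Longrightarrow> ext_d1 \<beta> x v w = 0"
  shows "\<exists>g. smooth_on (ball x0 r) g \<and> (\<forall>x\<in>ball x0 r. fd g x = \<beta> x)"
proof -
  let ?B = "ball x0 r" and ?I = "cbox 0 (1::real)"
  define c where "c s x = x0 + s *\<^sub>R (x - x0)" for s :: real and x
  have cB: "c s x \<in> ?B" if "x \<in> ?B" "s \<in> ?I" for s x
  proof -
    have "norm (s *\<^sub>R (x - x0)) \<le> norm (x - x0)" using that by (simp add: mult_left_le_one_le)
    then show ?thesis using that by (simp add: c_def dist_norm norm_minus_commute)
  qed
  \<comment> \<open>The derivative along \<open>v\<close> of the integrand \<beta>(c s x)(x - x0),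
    after closedness has exchanged \<open>v\<close> and \<open>x - x0\<close>. In this order it is
    also the \<open>s\<close>-derivative of s \<beta>(c s x)(v), which makes its integral
    computable.\<close>
  define K where "K x s v = s * fd (\<lambda>z. \<beta> z v) (c s x) (x - x0) + \<beta> (c s x) v" for x s v
  have cder: "(c s has_derivative (\<lambda>v. s *\<^sub>R v)) (at x)" for s x
    unfolding c_def by (auto intro!: derivative_eq_intros)
  have der: "((\<lambda>x. \<beta> (c s x) (x - x0)) has_derivative K x s) (at x)" if x: "x \<in> ?B" and s: "s \<in> ?I" for x s
  proof -
    have sm: "smooth_on ?B (c s)"
      unfolding c_def
      by (intro smooth_on_add smooth_on_const open_ball smooth_on_bounded_linear_compose[OF bounded_linear_scaleR_right]
          smooth_on_diff smooth_on_bounded_linear[OF bounded_linear_ident])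
    have form: "one_form_on ?B (\<lambda>z. \<beta> (c s z))"
      unfolding one_form_on_def using cB[OF _ s] one_form_on_linear[OF \<beta>]
      by (auto intro!: smooth_on_compose[OF open_ball open_ball _ sm one_form_on_smooth[OF \<beta>]])
    have d: "fd (\<lambda>z. \<beta> (c s z) w) x v = s * fd (\<lambda>z. \<beta> z w) (c s x) v" for v w
    proof -
      note h = smooth_on_has_derivative[OF one_form_on_smooth[OF \<beta>] cB[OF x s], of w]
      have "((\<lambda>z. \<beta> (c s z) w) has_derivative (\<lambda>v. fd (\<lambda>z. \<beta> z w) (c s x) (s *\<^sub>R v))) (at x)"
        using has_derivative_compose[OF cder h] .
      then show ?thesis
        using linear_cmul[OF smooth_on_linear_fd[OF one_form_on_smooth[OF \<beta>] cB[OF x s]]]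
        by (simp add: fd_unique)
    qed
    have "((\<lambda>x. x - x0) has_derivative (\<lambda>v. v)) (at x)"
      by (auto intro!: derivative_eq_intros)
    from has_derivative_one_form_apply[OF open_ball x form this]
    have "((\<lambda>x. \<beta> (c s x) (x - x0)) has_derivative
        (\<lambda>v. s * fd (\<lambda>z. \<beta> z (x - x0)) (c s x) v + \<beta> (c s x) v)) (at x)"
      by (simp add: d)
    moreover have "fd (\<lambda>z. \<beta> z (x - x0)) (c s x) v = fd (\<lambda>z. \<beta> z v) (c s x) (x - x0)" for v
      using closed[OF cB[OF x s], of v "x - x0"] by (simp add: ext_d1_def)
    ultimately show ?thesis by (simp add: K_def[abs_def])
  qed
  have ccont: "continuous_on (?B \<times> ?I) (\<lambda>p. c (snd p) (fst p))"
    unfolding c_def by (intro continuous_intros)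
  have cimg: "(\<lambda>p. c (snd p) (fst p)) ` (?B \<times> ?I) \<subseteq> ?B" using cB by auto
  have Kcont: "continuous_on (?B \<times> ?I) (\<lambda>p. K (fst p) (snd p) v)" for v
  proof -
    have "continuous_on (?B \<times> ?I) (\<lambda>p. fd (\<lambda>z. \<beta> z v) (c (snd p) (fst p)) b)" for b
      by (rule continuous_on_compose2[OF smooth_on_imp_continuous_on[OF smooth_on_fd[OF one_form_on_smooth[OF \<beta>]]] ccont cimg])
    moreover have "continuous_on (?B \<times> ?I) (\<lambda>p. \<beta> (c (snd p) (fst p)) v)"
      by (rule continuous_on_compose2[OF smooth_on_imp_continuous_on[OF one_form_on_smooth[OF \<beta>]] ccont cimg])
    ultimately have "continuous_on (?B \<times> ?I) (\<lambda>p. snd p * (\<Sum>b\<in>Basis. ((fst p - x0) \<bullet> b) *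
        fd (\<lambda>z. \<beta> z v) (c (snd p) (fst p)) b) + \<beta> (c (snd p) (fst p)) v)"
      by (intro continuous_intros)
    moreover have "fd (\<lambda>z. \<beta> z v) (c s x) u = (\<Sum>b\<in>Basis. (u \<bullet> b) * fd (\<lambda>z. \<beta> z v) (c s x) b)"
      if "x \<in> ?B" "s \<in> ?I" for x s u
      by (rule linear_expand[OF smooth_on_linear_fd[OF one_form_on_smooth[OF \<beta>] cB[OF that]]])
    ultimately show ?thesis unfolding K_def by (subst continuous_on_cong[OF refl]) (auto simp del: cbox_interval)
  qed
  \<comment> \<open>Differentiation under the integral sign is carried out for operator-valued
    functions of \<open>s\<close>, so the derivatives are packed as bounded linear
    functions.\<close>
  have bl: "blinfun_apply (Blinfun (K x s)) = K x s" if "x \<in> ?B" "s \<in> ?I" for x s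
    by (rule bounded_linear_Blinfun_apply[OF has_derivative_bounded_linear[OF der[OF that]]])
  define g where "g x = integral ?I (\<lambda>s. \<beta> (c s x) (x - x0))" for x
  have cont_bl: "continuous_on (?B \<times> ?I) (\<lambda>(x, s). Blinfun (K x s))"
  proof (rule continuous_on_blinfun_componentwise)
    fix i :: 'a
    show "continuous_on (?B \<times> ?I) (\<lambda>p. blinfun_apply (case p of (x, s) \<Rightarrow> Blinfun (K x s)) i)"
      using Kcont[of i] by (rule continuous_on_eq) (auto simp: bl simp del: cbox_interval)
  qed
  have ray: "((\<lambda>s. c s x) has_derivative (\<lambda>h. h *\<^sub>R (x - x0))) (at s within T)" for s x T
    unfolding c_def by (auto intro!: derivative_eq_intros)
  have radial: "((\<lambda>s. s * \<beta> (c s x) v) has_vector_derivative K x s v) (at s within ?I)"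
    if x: "x \<in> ?B" and s: "s \<in> ?I" for x s v
  proof -
    note h = smooth_on_has_derivative[OF one_form_on_smooth[OF \<beta>] cB[OF x s], of v]
    have "((\<lambda>s. \<beta> (c s x) v) has_derivative (\<lambda>h. fd (\<lambda>z. \<beta> z v) (c s x) (h *\<^sub>R (x - x0)))) (at s within ?I)"
      using has_derivative_compose[OF ray h] .
    then have "((\<lambda>s. \<beta> (c s x) v) has_derivative (\<lambda>h. h * fd (\<lambda>z. \<beta> z v) (c s x) (x - x0))) (at s within ?I)"
      using linear_cmul[OF smooth_on_linear_fd[OF one_form_on_smooth[OF \<beta>] cB[OF x s]]] by simp
    from has_derivative_mult[OF has_derivative_ident this]
    show ?thesis by (simp add: has_vector_derivative_def K_def algebra_simps)
  qed
  have "(g has_derivative \<beta> x) (at x)" if x: "x \<in> ?B" for x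
  proof -
    have integ: "(\<lambda>s. \<beta> (c s y) (y - x0)) integrable_on ?I" if y: "y \<in> ?B" for y
    proof (rule integrable_continuous)
      have "continuous_on ?I (\<lambda>s. c s y)" unfolding c_def by (intro continuous_intros)
      then show "continuous_on ?I (\<lambda>s. \<beta> (c s y) (y - x0))"
        by (rule continuous_on_compose2[OF smooth_on_imp_continuous_on[OF one_form_on_smooth[OF \<beta>]]])
          (use cB[OF y] in auto)
    qed
    have "(g has_derivative integral ?I (\<lambda>s. Blinfun (K x s))) (at x within ?B)"
      unfolding g_def
    proof (rule leibniz_rule[OF _ integ cont_bl x convex_ball])
      show "((\<lambda>x. \<beta> (c s x) (x - x0)) has_derivative blinfun_apply (Blinfun (K y s))) (at y within ?B)"
        if "y \<in> ?B" "s \<in> ?I" for y s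
        unfolding bl[OF that] by (rule has_derivative_at_withinI[OF der[OF that]])
    qed
    moreover have "blinfun_apply (integral ?I (\<lambda>s. Blinfun (K x s))) v = \<beta> x v" for v
    proof -
      have "continuous_on ?I (\<lambda>s. (x, s))" by (intro continuous_intros)
      from continuous_on_compose2[OF cont_bl this]
      have "continuous_on ?I (\<lambda>s. Blinfun (K x s))" using x by (auto simp: image_subset_iff simp del: cbox_interval)
      then have i: "(\<lambda>s. Blinfun (K x s)) integrable_on ?I" by (rule integrable_continuous)
      have "blinfun_apply (integral ?I (\<lambda>s. Blinfun (K x s))) v =
          integral ?I (\<lambda>s. blinfun_apply (Blinfun (K x s)) v)"
        using integral_linear[OF i blinfun.bounded_linear_left[of v]] by (simp add: o_def)
      also have "\<dots> = integral ?I (\<lambda>s. K x s v)" by (rule integral_cong) (simp add: bl[OF x])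
      \<comment> \<open>The factor \<open>s\<close> kills the contribution of the centre, and
        \<open>c 1 x\<close> is \<open>x\<close>, so only \<beta> at \<open>x\<close> is
        left.\<close>
      also have "\<dots> = 1 * \<beta> (c 1 x) v - 0 * \<beta> (c 0 x) v"
        using fundamental_theorem_of_calculus[of 0 "1::real" "\<lambda>s. s * \<beta> (c s x) v" "\<lambda>s. K x s v"] radial[OF x]
        by (simp add: integral_unique)
      finally show ?thesis by (simp add: c_def)
    qed
    then have "blinfun_apply (integral ?I (\<lambda>s. Blinfun (K x s))) = \<beta> x" by (rule ext)
    ultimately show ?thesis using x by (simp add: at_within_open[OF _ open_ball])
  qed
  then have "smooth_on ?B g" "\<forall>x\<in>?B. fd g x = \<beta> x"
    using smooth_on_from_derivative[of ?B g \<beta>] one_form_on_smooth[OF \<beta>] by (auto simp: fd_unique)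
  then show ?thesis by blast
qed

section \<open>Semi-basic forms in induced coordinates\<close>

definition vert :: "'n::finite jspace \<Rightarrow> 'n jspace \<Rightarrow> 'n jspace" where
  "vert x v = (0, 0, fst (snd v) - fst v *\<^sub>R snd (snd x))"

text \<open>On functions \<open>d_J L\<close> is dL composed with the vertical endomorphism, so this
  is \<open>\<theta>\<^sub>L\<close> in coordinates.\<close>

definition pc :: "('n::finite jspace \<Rightarrow> real) \<Rightarrow> 'n jspace \<Rightarrow> 'n jspace \<Rightarrow> real" where
  "pc L x v = L x * fst v + fd L x (vert x v)"

definition semi_basic_on :: "'n::finite jspace set \<Rightarrow> ('n jspace \<Rightarrow> 'n jspace \<Rightarrow> real) \<Rightarrow> bool" where
  "semi_basic_on U \<alpha> \<longleftrightarrow> (\<forall>x\<in>U. \<forall>w. \<alpha> x (0, 0, w) = 0)"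

lemma linear_vert: "linear (vert x)"
  by (rule linearI) (simp_all add: vert_def algebra_simps)

lemma has_derivative_vert:
  "((\<lambda>z. vert z v) has_derivative (\<lambda>h. (0, 0, - (fst v *\<^sub>R snd (snd h))))) (at x)"
  unfolding vert_def by (auto intro!: derivative_eq_intros)

lemma smooth_on_vert:
  assumes "open U" shows "smooth_on U (\<lambda>z. vert z v)"
  by (rule smooth_on_from_derivative[OF has_derivative_vert smooth_on_const assms])

lemma one_form_on_pc:
  assumes U: "open U" and L: "smooth_on U L"
  shows "one_form_on U (pc L)"
  unfolding one_form_on_def
proof (intro conjI ballI allI)
  fix x assume x: "x \<in> U"
  have "linear (\<lambda>v. fd L x (vert x v))"
    using linear_compose[OF linear_vert smooth_on_linear_fd[OF L x]] by (simp add: o_def)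
  moreover have "linear (\<lambda>v. L x * fst v)" by (rule linearI) (simp_all add: algebra_simps)
  ultimately show "linear (pc L x)"
    using linear_compose_add[of "\<lambda>v. L x * fst v" "\<lambda>v. fd L x (vert x v)"] by (simp add: pc_def[abs_def])
next
  fix v
  show "smooth_on U (\<lambda>x. pc L x v)"
    unfolding pc_def
    by (intro smooth_on_add smooth_on_mult smooth_on_const smooth_on_one_form_apply one_form_on_fd
        smooth_on_vert U L)
qed

lemma pc_vertical: "smooth_on U L \<Longrightarrow> x \<in> U \<Longrightarrow> pc L x (0, 0, w) = 0"
  by (simp add: pc_def vert_def smooth_on_linear_fd linear_0 flip: zero_prod_def)

lemma semi_basic_on_pc: "smooth_on U L \<Longrightarrow> semi_basic_on U (pc L)"
  by (simp add: semi_basic_on_def pc_vertical)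

lemma linear_mult_dt: "linear (\<lambda>v::'n::finite jspace. c * fst v)"
  by (rule linearI) (simp_all add: algebra_simps)

lemma one_form_on_mult_dt:
  fixes f :: "'n::finite jspace \<Rightarrow> real"
  assumes "open U" "smooth_on U f"
  shows "one_form_on U (\<lambda>x v. f x * fst v)"
  unfolding one_form_on_def
  by (intro conjI ballI allI linear_mult_dt smooth_on_mult smooth_on_const assms)

lemma ext_d1_mult_dt:
  assumes "smooth_on U f" "x \<in> U"
  shows "ext_d1 (\<lambda>x v. f x * fst v) x v w = fd f x v * fst w - fd f x w * fst v"
proof -
  have "fd (\<lambda>x. f x * c) x = (\<lambda>v. fd f x v * c)" for c
    using smooth_on_has_derivative[OF assms] by (intro fd_unique has_derivative_mult_left)
  then show ?thesis by (simp add: ext_d1_def)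
qed

lemma fd_zero_on_open:
  assumes "open U" "x \<in> U" "\<And>z. z \<in> U \<Longrightarrow> f z = 0"
  shows "fd f x v = 0"
  using fd_cong_open[OF assms(1,2), of f "\<lambda>_. 0"] assms(3) by (simp add: frechet_derivative_const)

text \<open>The right side is the Hessian of \<open>L\<close> on the vertical parts. The first-order
  term coming from L dt is cancelled by the one from the dependence of J on \<open>y\<close>, since
  the derivative of J w along J v is -dt(w) J v.\<close>

lemma ext_d1_pc_vert:
  assumes U: "open U" "x \<in> U" and L: "smooth_on U L"
  shows "ext_d1 (pc L) x (vert x v) w = fd (\<lambda>z. fd L z (vert x w)) x (vert x v)"
proof -
  let ?u = "vert x v"
  have lin: "linear (fd L x)" using smooth_on_linear_fd[OF L U(2)] .
  have "fd (\<lambda>z. pc L z ?u) x w = 0"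
    by (rule fd_zero_on_open[OF U]) (simp add: vert_def pc_vertical[OF L])
  moreover have "((\<lambda>z. pc L z w) has_derivative (\<lambda>h. fd L x h * fst w +
      (fd (\<lambda>z. fd L z (vert x w)) x h + fd L x (0, 0, - (fst w *\<^sub>R snd (snd h)))))) (at x)"
    unfolding pc_def
    by (intro has_derivative_add has_derivative_mult_left smooth_on_has_derivative[OF L U(2)]
        has_derivative_one_form_apply[OF U one_form_on_fd[OF L]] has_derivative_vert)
  moreover have "fd L x (0, 0, - (fst w *\<^sub>R snd (snd ?u))) = - fst w * fd L x ?u"
    using linear_cmul[OF lin, of "- fst w" ?u] by (simp add: vert_def)
  ultimately show ?thesis by (simp add: ext_d1_def fd_unique)
qed

text \<open>The Hessian is symmetric and \<open>ext_d1\<close> is skew. Since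
  \<open>\<theta>\<^sub>L\<close> is semi-basic, its contraction with J vanishes, and this sum is
  all of \<open>d_J \<theta>\<^sub>L\<close>.\<close>

lemma d_J_pc_eq_0:
  assumes U: "open U" "x \<in> U" and L: "smooth_on U L"
  shows "ext_d1 (pc L) x (vert x v) w + ext_d1 (pc L) x v (vert x w) = 0"
  unfolding ext_d1_skew[of _ x v] ext_d1_pc_vert[OF assms]
  using symmetric_second_derivative[OF assms] by simp

section \<open>Semisprays in one chart\<close>

locale spray_chart =
  fixes U :: "'n::finite jspace set" and S :: "'n jspace \<Rightarrow> 'n jspace"
  assumes open_U: "open U" and smooth_S: "smooth_on U S"
    and fst_S: "x \<in> U \<Longrightarrow> fst (S x) = 1"
    and snd_S: "x \<in> U \<Longrightarrow> fst (snd (S x)) = snd (snd x)"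
begin

lemma vert_S: "x \<in> U \<Longrightarrow> vert x (S x) = 0"
  by (simp add: vert_def fst_S snd_S zero_prod_def)

lemma pc_S: "smooth_on U L \<Longrightarrow> x \<in> U \<Longrightarrow> pc L x (S x) = L x"
  by (simp add: pc_def vert_S fst_S smooth_on_linear_fd linear_0)

text \<open>Differentiation of the two identities that define a semispray. For the constant field
  (0, 0, w) it says that the bracket with \<open>S\<close> is (0, w, 0) up to vertical
  vectors.\<close>

lemma fd_S:
  assumes x: "x \<in> U"
  shows "fst (fd S x v) = 0" "fst (snd (fd S x v)) = snd (snd v)"
proof -
  note S' = smooth_on_has_derivative[OF smooth_S x]
  have "((\<lambda>z. fst (S z)) has_derivative (\<lambda>v. fst (fd S x v))) (at x)"
    by (rule has_derivative_fst[OF S'])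
  moreover have "((\<lambda>z. fst (S z)) has_derivative (\<lambda>v. 0)) (at x)"
    by (rule has_derivative_cong_open[OF has_derivative_const open_U x]) (simp add: fst_S)
  ultimately show "fst (fd S x v) = 0" by (rule has_derivative_unique[THEN fun_cong])
  have "((\<lambda>z. fst (snd (S z))) has_derivative (\<lambda>v. fst (snd (fd S x v)))) (at x)"
    by (rule has_derivative_fst[OF has_derivative_snd[OF S']])
  moreover have "((\<lambda>z. fst (snd (S z))) has_derivative (\<lambda>v. snd (snd v))) (at x)"
    by (rule has_derivative_cong_open[OF has_derivative_snd[OF has_derivative_snd[OF has_derivative_ident]] open_U x])
      (simp add: snd_S)
  ultimately show "fst (snd (fd S x v)) = snd (snd v)" by (rule has_derivative_unique[THEN fun_cong])
qed

lemma semi_basic_eq: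
  assumes \<alpha>: "linear (\<alpha> x)" "\<And>w. \<alpha> x (0, 0, w) = 0" and x: "x \<in> U"
  shows "\<alpha> x v = fst v * \<alpha> x (S x) + \<alpha> x (0, fst (snd v) - fst v *\<^sub>R snd (snd x), 0)"
proof -
  \<comment> \<open>Subtracting dt(v) S leaves a vector without \<open>t\<close>-part whose
    \<open>x\<close>-part is \<delta>x(v); the rest is vertical.\<close>
  have "v = fst v *\<^sub>R S x + (0, fst (snd v) - fst v *\<^sub>R snd (snd x), 0)
      + (0, 0, snd (snd v) - fst v *\<^sub>R snd (snd (S x)))"
    using fst_S[OF x] snd_S[OF x] by (simp add: prod_eq_iff)
  then have "\<alpha> x v = \<alpha> x (fst v *\<^sub>R S x + (0, fst (snd v) - fst v *\<^sub>R snd (snd x), 0)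
      + (0, 0, snd (snd v) - fst v *\<^sub>R snd (snd (S x))))" by metis
  then show ?thesis using \<alpha>(2) unfolding linear_add[OF \<alpha>(1)] linear_cmul[OF \<alpha>(1)] by simp
qed

text \<open>Cartan's formula on a constant vertical vector: \<alpha> vanishes on it throughout
  \<open>U\<close>, and the derivative of \<open>S\<close> turns it into (0, w, 0) up to vertical
  vectors.\<close>

lemma contr_ext_d1_vertical:
  assumes \<alpha>: "one_form_on U \<alpha>" and sb: "semi_basic_on U \<alpha>" and x: "x \<in> U"
  shows "ext_d1 \<alpha> x (S x) (0, 0, w) = \<alpha> x (0, w, 0) - fd (\<lambda>z. \<alpha> z (S z)) x (0, 0, w)"
proof -
  have "fd (\<lambda>z. \<alpha> z (0, 0, w)) x (S x) = 0"
    using sb by (intro fd_zero_on_open[OF open_U x]) (simp add: semi_basic_on_def)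
  moreover have "\<alpha> x (fd S x (0, 0, w)) = \<alpha> x (0, w, 0)"
  proof -
    have "fd S x (0, 0, w) = (0, w, 0) + (0, 0, snd (snd (fd S x (0, 0, w))))"
      using fd_S[OF x, of "(0, 0, w)"] by (simp add: prod_eq_iff)
    then have "\<alpha> x (fd S x (0, 0, w)) = \<alpha> x ((0, w, 0) + (0, 0, snd (snd (fd S x (0, 0, w)))))" by metis
    also have "\<dots> = \<alpha> x (0, w, 0)"
      using sb x unfolding linear_add[OF one_form_on_linear[OF \<alpha> x]] by (simp add: semi_basic_on_def)
    finally show ?thesis .
  qed
  ultimately show ?thesis
    using cartan_one_form[OF open_U x \<alpha> smooth_S, of "(0, 0, w)"] by simp
qed

text \<open>With d\<alpha> = 0 and \<alpha>(S) = 0 the formula for vertical vectors leaves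
  \<alpha>(0, w, 0) = 0, and the splitting along \<open>S\<close> contributes no other term.\<close>

lemma closed_semi_basic_eq_0:
  assumes \<alpha>: "one_form_on U \<alpha>" and sb: "semi_basic_on U \<alpha>"
    and closed: "\<And>x v w. x \<in> U \<Longrightarrow> ext_d1 \<alpha> x v w = 0"
    and S: "\<And>x. x \<in> U \<Longrightarrow> \<alpha> x (S x) = 0" and x: "x \<in> U"
  shows "\<alpha> x v = 0"
proof -
  have "\<alpha> x (0, w, 0) = 0" for w
    using contr_ext_d1_vertical[OF \<alpha> sb x, of w] closed[OF x]
      fd_zero_on_open[OF open_U x, of "\<lambda>z. \<alpha> z (S z)"] S by simp
  then show ?thesis
    using semi_basic_eq[of \<alpha>, OF one_form_on_linear[OF \<alpha> x] _ x, of v] sb S[OF x] x by (simp add: semi_basic_on_def)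
qed

text \<open>By the formula for vertical vectors the components \<theta>(0, w, 0) are
  \<open>y\<close>-derivatives of i_S \<theta> - f, as in a Poincare-Cartan form. Since df enters on
  vertical vectors only, the lemma serves both f = 0 with i_S d\<theta> semi-basic and a primitive
  of -i_S d\<theta>.\<close>

lemma semi_basic_decomposition:
  assumes \<theta>: "one_form_on U \<theta>" and sb: "semi_basic_on U \<theta>" and f: "smooth_on U f"
    and df: "\<And>x w. x \<in> U \<Longrightarrow> ext_d1 \<theta> x (S x) (0, 0, w) = - fd f x (0, 0, w)" and x: "x \<in> U"
  shows "\<theta> x v = pc (\<lambda>z. \<theta> z (S z) - f z) x v + f x * fst v"
proof -
  have "fd (\<lambda>z. \<theta> z (S z) - f z) x = (\<lambda>v. fd (\<lambda>z. \<theta> z (S z)) x v - fd f x v)"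
    by (intro fd_unique has_derivative_diff smooth_on_has_derivative[OF _ x] f
        smooth_on_one_form_apply[OF open_U \<theta> smooth_S])
  then have "\<theta> x (0, w, 0) = fd (\<lambda>z. \<theta> z (S z) - f z) x (0, 0, w)" for w
    using contr_ext_d1_vertical[OF \<theta> sb x, of w] df[OF x, of w] by simp
  then show ?thesis
    using semi_basic_eq[of \<theta>, OF one_form_on_linear[OF \<theta> x] _ x, of v] sb x
    by (simp add: semi_basic_on_def pc_def vert_def algebra_simps)
qed

text \<open>As \<open>\<theta>\<^sub>L(S) = L\<close>, Cartan's formula turns the Euler-Lagrange
  equation into \<open>i_S d\<theta>\<^sub>L = 0\<close>.\<close>

lemma lie_pc_iff:
  assumes L: "smooth_on U L" and x: "x \<in> U"
  shows "fd (\<lambda>z. pc L z w) x (S x) + pc L x (fd S x w) = fd L x w \<longleftrightarrow> ext_d1 (pc L) x (S x) w = 0"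
proof -
  have "fd (\<lambda>z. pc L z (S z)) x = fd L x"
    by (rule fd_cong_open[OF open_U x]) (simp add: pc_S[OF L])
  then show ?thesis using cartan_one_form[OF open_U x one_form_on_pc[OF open_U L] smooth_S, of w] by simp
qed

section \<open>The forms \<open>\<theta>\<^sub>L + f dt\<close> in one chart\<close>

context
  fixes \<theta> L f
  assumes L: "smooth_on U L" and f: "smooth_on U f"
    and Sf: "\<And>x. x \<in> U \<Longrightarrow> fd f x (S x) = 0"
    and \<theta>: "\<And>x v. x \<in> U \<Longrightarrow> \<theta> x v = pc L x v + f x * fst v"
begin

lemma one_form_on_pc_plus: "one_form_on U \<theta>"
  by (rule one_form_on_cong[OF open_U one_form_on_add[OF open_U one_form_on_pc[OF open_U L]
          one_form_on_mult_dt[OF open_U f]]]) (simp add: \<theta>)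

lemma ext_d1_pc_plus:
  assumes x: "x \<in> U"
  shows "ext_d1 \<theta> x v w = ext_d1 (pc L) x v w + (fd f x v * fst w - fd f x w * fst v)"
proof -
  have "ext_d1 \<theta> x v w = ext_d1 (\<lambda>x v. pc L x v + f x * fst v) x v w"
    by (rule ext_d1_cong_open[OF open_U x \<theta>])
  then show ?thesis
    by (simp add: ext_d1_add[OF one_form_on_pc[OF open_U L] one_form_on_mult_dt[OF open_U f] x]
        ext_d1_mult_dt[OF f x])
qed

lemma contr_ext_d1_pc_plus:
  assumes x: "x \<in> U"
  shows "ext_d1 \<theta> x (S x) w = ext_d1 (pc L) x (S x) w - fd f x w"
  using Sf[OF x] fst_S[OF x] by (simp add: ext_d1_pc_plus[OF x])

lemma euler_lagrange_iff_closed: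
  "(\<forall>x\<in>U. \<forall>w. ext_d1 (pc L) x (S x) w = 0) \<longleftrightarrow>
   (\<forall>x\<in>U. \<forall>v w. ext_d1 (\<lambda>x. ext_d1 \<theta> x (S x)) x v w = 0)" (is "?l \<longleftrightarrow> ?r")
proof
  assume l: ?l
  show ?r
  proof (intro ballI allI)
    fix x v w assume x: "x \<in> U"
    have m: "smooth_on U (\<lambda>z. - f z)" by (rule smooth_on_uminus[OF open_U f])
    have "fd (\<lambda>z. - f z) z w = - fd f z w" if "z \<in> U" for z w
      using fd_unique[OF has_derivative_minus[OF smooth_on_has_derivative[OF f that]]] by simp
    \<comment> \<open>Here \<open>i_S d\<theta>\<^sub>L\<close> vanishes, so i_S d\<theta> = -df is
      exact.\<close>
    then have "ext_d1 (\<lambda>x. ext_d1 \<theta> x (S x)) x v w = ext_d1 (fd (\<lambda>z. - f z)) x v w"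
      using l by (intro ext_d1_cong_open[OF open_U x]) (simp only: contr_ext_d1_pc_plus)
    then show "ext_d1 (\<lambda>x. ext_d1 \<theta> x (S x)) x v w = 0" by (simp add: ext_d1_fd[OF open_U x m])
  qed
next
  assume r: ?r
  note pcL = one_form_on_pc[OF open_U L]
  let ?\<gamma> = "\<lambda>x. ext_d1 (pc L) x (S x)"
  show ?l
  proof (intro ballI allI)
    fix x w assume x: "x \<in> U"
    show "?\<gamma> x w = 0"
    proof (rule closed_semi_basic_eq_0[OF one_form_on_contr_ext_d1[OF open_U pcL smooth_S] _ _ _ x])
      show "semi_basic_on U ?\<gamma>"
        unfolding semi_basic_on_def
      proof (intro ballI allI)
        fix x w assume x: "x \<in> U"
        \<comment> \<open>Because \<open>\<theta>\<^sub>L(S) = L\<close>, both terms in the formula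
          for vertical vectors are the \<open>y\<close>-derivative of \<open>L\<close>, and they
          cancel.\<close>
        have "fd (\<lambda>z. pc L z (S z)) x = fd L x"
          by (rule fd_cong_open[OF open_U x]) (simp add: pc_S[OF L])
        then show "?\<gamma> x (0, 0, w) = 0"
          using contr_ext_d1_vertical[OF pcL semi_basic_on_pc[OF L] x, of w]
          by (simp add: pc_def vert_def)
      qed
      show "?\<gamma> x (S x) = 0" for x by (simp add: ext_d1_def)
      show "ext_d1 ?\<gamma> x v w = 0" if x: "x \<in> U" for x v w
      proof -
        \<comment> \<open>\<open>?\<gamma>\<close> is i_S d\<theta> + df, a sum of two closed
          forms.\<close>
        have "ext_d1 ?\<gamma> x v w = ext_d1 (\<lambda>x w. ext_d1 \<theta> x (S x) w + fd f x w) x v w"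
          by (rule ext_d1_cong_open[OF open_U x]) (simp add: contr_ext_d1_pc_plus)
        also have "\<dots> = 0"
          using r[rule_format, OF x, of v w] ext_d1_add[OF one_form_on_contr_ext_d1[OF open_U one_form_on_pc_plus smooth_S] one_form_on_fd[OF f] x]
          by (simp add: ext_d1_fd[OF open_U x f])
        finally show ?thesis .
      qed
    qed
  qed
qed

text \<open>The correction i_S d\<theta> \<and> dt equals -df \<and> dt and removes exactly the
  contribution of f dt to d\<theta>. This is what identifies non-degeneracy of \<theta> with
  regularity of \<open>L\<close>.\<close>

lemma wedge_ext_d1_pc_plus:
  assumes "x \<in> U" "\<And>w. ext_d1 (pc L) x (S x) w = 0"
  shows "ext_d1 \<theta> x v w + (ext_d1 \<theta> x (S x) v * fst w - ext_d1 \<theta> x (S x) w * fst v) = ext_d1 (pc L) x v w"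
  using assms by (simp add: contr_ext_d1_pc_plus) (simp add: ext_d1_pc_plus)

end

end

section \<open>Charts and jets\<close>

lemma is_chart_inj: "is_chart c \<Longrightarrow> inj_on (snd c) (fst c)"
  by (auto simp: is_chart_def homeomorphism_def intro: inj_on_inverseI split: prod.splits)

lemma is_chart_open: "is_chart c \<Longrightarrow> open (fst c)"
  by (auto simp: is_chart_def split: prod.splits)

lemma is_chart_open_image:
  assumes c: "is_chart c" and "A \<subseteq> fst c" "open A"
  shows "open (snd c ` A)"
proof -
  have "homeomorphism (fst c) (snd c ` fst c) (snd c) (inv_into (fst c) (snd c))"
    and o: "open (snd c ` fst c)"
    using c by (auto simp: is_chart_def split: prod.splits)
  moreover have "openin (top_of_set (fst c)) A" using assms by (simp add: open_subset)
  ultimately have "openin (top_of_set (snd c ` fst c)) (snd c ` A)"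
    using homeomorphism_imp_open_map by blast
  then show ?thesis using o openin_open_trans by blast
qed

definition chart_trans ::
  "('m::topological_space, 'n::finite) chart \<Rightarrow> ('m, 'n) chart \<Rightarrow> 'n mspace \<Rightarrow> 'n mspace" where
  "chart_trans c c' = snd c' \<circ> inv_into (fst c) (snd c)"

lemma chart_trans_apply:
  "is_chart c \<Longrightarrow> p \<in> fst c \<Longrightarrow> chart_trans c c' (snd c p) = snd c' p"
  by (simp add: chart_trans_def inv_into_f_f is_chart_inj)

lemma compatible_iff:
  "compatible c c' \<longleftrightarrow> smooth_on (snd c ` (fst c \<inter> fst c')) (chart_trans c c') \<and>
    smooth_on (snd c' ` (fst c \<inter> fst c')) (chart_trans c' c)"
  by (simp add: compatible_def chart_trans_def split: prod.splits)

text \<open>The definition of the maximal atlas compares its members with atlas charts, not with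
  each other. Near each point the change of charts therefore factors through an atlas chart
  \<open>a\<close> around it.\<close>

lemma smooth_on_chart_trans:
  assumes A: "smooth_atlas A" and c: "c \<in> max_atlas A" and c': "c' \<in> max_atlas A"
  shows "smooth_on (snd c ` (fst c \<inter> fst c')) (chart_trans c c')"
proof (rule smooth_on_local)
  fix z assume "z \<in> snd c ` (fst c \<inter> fst c')"
  then obtain p where p: "p \<in> fst c" "p \<in> fst c'" "z = snd c p" by auto
  have "p \<in> (\<Union>c\<in>A. fst c)" using A by (simp add: smooth_atlas_def)
  then obtain a where a: "a \<in> A" "p \<in> fst a" by blast
  have ch: "is_chart c" "is_chart c'" "is_chart a"
    using A c c' a by (auto simp: smooth_atlas_def max_atlas_def)
  have comp: "compatible c a" "compatible c' a" using c c' a by (auto simp: max_atlas_def)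
  let ?N = "snd c ` (fst c \<inter> fst c' \<inter> fst a)"
  have N: "open ?N" and M: "open (snd a ` (fst c' \<inter> fst a))"
    using ch by (auto intro!: is_chart_open_image open_Int is_chart_open)
  have "smooth_on ?N (\<lambda>z. chart_trans a c' (chart_trans c a z))"
  proof (rule smooth_on_compose[OF N M, where f = "chart_trans c a"])
    show "smooth_on ?N (chart_trans c a)" using comp(1) by (auto simp: compatible_iff elim: smooth_on_subset)
    show "chart_trans c a ` ?N \<subseteq> snd a ` (fst c' \<inter> fst a)" by (auto simp: chart_trans_apply ch)
    show "smooth_on (snd a ` (fst c' \<inter> fst a)) (chart_trans a c')" using comp(2) by (simp add: compatible_iff)
  qed
  then have "smooth_on ?N (chart_trans c c')"
    by (rule smooth_on_cong[OF N]) (auto simp: chart_trans_apply ch)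
  then show "\<exists>N. open N \<and> z \<in> N \<and> smooth_on N (chart_trans c c')"
    using N p a by blast
qed

lemma atlas_subset_max_atlas: "smooth_atlas A \<Longrightarrow> A \<subseteq> max_atlas A"
  by (auto simp: smooth_atlas_def max_atlas_def)

definition jet_chart_dom ::
  "('m::topological_space, 'n::finite) chart \<Rightarrow> ('m, 'n) chart \<Rightarrow> 'n jspace set" where
  "jet_chart_dom c c' = {x. (fst x, fst (snd x)) \<in> snd c ` (fst c \<inter> fst c')}"

text \<open>The prolongation of the change of charts: a section has velocity (1, y) in an adapted
  chart, the derivative of the transition maps velocities to velocities, and \<open>t\<close> is
  common to adapted charts.\<close>

definition jet_chart_trans ::
  "('m::topological_space, 'n::finite) chart \<Rightarrow> ('m, 'n) chart \<Rightarrow> 'n jspace \<Rightarrow> 'n jspace" where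
  "jet_chart_trans c c' x = (fst x, snd (chart_trans c c' (fst x, fst (snd x))),
     snd (fd (chart_trans c c') (fst x, fst (snd x)) (1, snd (snd x))))"

section \<open>Local sections, jets and induced coordinates\<close>

locale fibred =
  fixes F :: "('m::{t2_space, second_countable_topology}, 'n::finite) fibration"
  assumes fibred: "fibred_manifold F"
begin

lemma smooth_atlas: "smooth_atlas (atlas F)"
  using fibred by (simp add: fibred_manifold_def)

lemma adapted_max_atlas: "c \<in> adapted F \<Longrightarrow> c \<in> max_atlas (atlas F)"
  by (simp add: adapted_def)

lemma adapted_is_chart: "c \<in> adapted F \<Longrightarrow> is_chart c"
  by (simp add: adapted_def max_atlas_def)

lemma adapted_fst: "c \<in> adapted F \<Longrightarrow> p \<in> fst c \<Longrightarrow> fst (snd c p) = proj F p"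
  by (simp add: adapted_def)

lemma local_section_near:
  assumes \<gamma>: "local_section F t \<gamma>" and A: "open A" "\<gamma> t \<in> A"
  shows "\<exists>I. open I \<and> t \<in> I \<and> (\<forall>s\<in>I. \<gamma> s \<in> A \<and> proj F (\<gamma> s) = s)"
proof -
  obtain I where I: "open I" "t \<in> I" "continuous_on I \<gamma>" "\<And>s. s \<in> I \<Longrightarrow> proj F (\<gamma> s) = s"
    using \<gamma> by (auto simp: local_section_def)
  have "open (I \<inter> \<gamma> -` A)" using continuous_open_preimage[OF I(3,1) A(1)] .
  then show ?thesis using I A(2) by (intro exI[of _ "I \<inter> \<gamma> -` A"]) auto
qed

lemma proj_local_section: "local_section F t \<gamma> \<Longrightarrow> proj F (\<gamma> t) = t"
  by (auto simp: local_section_def)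

text \<open>A local section is smooth by definition in atlas charts; the chain rule carries
  differentiability to the maximal atlas and hence to adapted charts.\<close>

lemma local_section_differentiable:
  assumes \<gamma>: "local_section F t \<gamma>" and c: "c \<in> max_atlas (atlas F)" and p: "\<gamma> t \<in> fst c"
  shows "(snd c \<circ> \<gamma>) differentiable (at t)"
proof -
  have "\<gamma> t \<in> (\<Union>c\<in>atlas F. fst c)" using smooth_atlas by (simp add: smooth_atlas_def)
  then obtain a where a: "a \<in> atlas F" "\<gamma> t \<in> fst a" by blast
  have am: "a \<in> max_atlas (atlas F)" using a atlas_subset_max_atlas[OF smooth_atlas] by blast
  have ch: "is_chart a" "is_chart c" using am c by (auto simp: max_atlas_def)
  obtain I where I: "t \<in> I" "smooth_on {s\<in>I. \<gamma> s \<in> fst a} (snd a \<circ> \<gamma>)"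
    using \<gamma> a by (auto simp: local_section_def split: prod.splits)
  have "(snd a \<circ> \<gamma>) differentiable (at t)"
    using smooth_on_imp_differentiable[OF I(2)] I(1) a by simp
  moreover have "chart_trans a c differentiable (at (snd a (\<gamma> t)))"
    using smooth_on_imp_differentiable[OF smooth_on_chart_trans[OF smooth_atlas am c]] a p by blast
  ultimately have d: "(chart_trans a c \<circ> (snd a \<circ> \<gamma>)) differentiable (at t)"
    by (intro differentiable_chain_at) simp_all
  obtain J where J: "open J" "t \<in> J" "\<And>s. s \<in> J \<Longrightarrow> \<gamma> s \<in> fst a"
    using local_section_near[OF \<gamma> is_chart_open[OF ch(1)] a(2)] by blast
  show ?thesis
    by (rule differentiable_cong_open[OF d J(1,2)]) (simp add: J(3) chart_trans_apply ch)
qed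

text \<open>In an adapted chart the first coordinate of \<gamma>(s) is s itself, so its derivative
  is 1 and the induced coordinate \<open>y\<close> determines the velocity.\<close>

lemma adapted_section_derivative:
  assumes \<gamma>: "local_section F t \<gamma>" and c: "c \<in> adapted F" and p: "\<gamma> t \<in> fst c"
  shows "((\<lambda>s. snd c (\<gamma> s)) has_vector_derivative
    (1, vector_derivative (\<lambda>s. snd (snd c (\<gamma> s))) (at t))) (at t)"
proof -
  define D where "D = vector_derivative (\<lambda>s. snd c (\<gamma> s)) (at t)"
  have D: "((\<lambda>s. snd c (\<gamma> s)) has_vector_derivative D) (at t)"
    using local_section_differentiable[OF \<gamma> adapted_max_atlas[OF c] p]
    by (simp add: D_def o_def vector_derivative_works)
  then have D': "((\<lambda>s. snd c (\<gamma> s)) has_derivative (\<lambda>h. h *\<^sub>R D)) (at t)"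
    by (simp add: has_vector_derivative_def)
  have "((\<lambda>s. snd (snd c (\<gamma> s))) has_vector_derivative snd D) (at t)"
    using has_derivative_snd[OF D'] by (simp add: has_vector_derivative_def)
  then have s: "vector_derivative (\<lambda>s. snd (snd c (\<gamma> s))) (at t) = snd D"
    by (rule vector_derivative_at)
  obtain I where I: "open I" "t \<in> I" "\<And>s. s \<in> I \<Longrightarrow> \<gamma> s \<in> fst c \<and> proj F (\<gamma> s) = s"
    using local_section_near[OF \<gamma> is_chart_open[OF adapted_is_chart[OF c]] p] by blast
  have "((\<lambda>s. s) has_derivative (\<lambda>h. h *\<^sub>R fst D)) (at t)"
    using has_derivative_cong_open[OF has_derivative_fst[OF D'] I(1,2), of "\<lambda>s. s"] I(3)
    by (simp add: adapted_fst[OF c])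
  then have "(\<lambda>h. h *\<^sub>R fst D) = (\<lambda>h. h)" using has_derivative_unique has_derivative_ident by blast
  then have "fst D = 1" by (metis mult_1 real_scaleR_def)
  then show ?thesis using D s by (metis prod.collapse)
qed

text \<open>Chain rule for velocities. The target \<open>c'\<close> ranges over the maximal atlas
  and not merely over adapted charts, because \<open>same_jet\<close> compares velocities in atlas
  charts.\<close>

lemma section_transition:
  assumes \<gamma>: "local_section F t \<gamma>" and c: "c \<in> adapted F" and c': "c' \<in> max_atlas (atlas F)"
    and p: "\<gamma> t \<in> fst c" "\<gamma> t \<in> fst c'"
  shows "((\<lambda>s. snd c' (\<gamma> s)) has_vector_derivative fd (chart_trans c c') (snd c (\<gamma> t))
    (1, vector_derivative (\<lambda>s. snd (snd c (\<gamma> s))) (at t))) (at t)"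
proof -
  let ?D = "(1, vector_derivative (\<lambda>s. snd (snd c (\<gamma> s))) (at t))"
  have sm: "smooth_on (snd c ` (fst c \<inter> fst c')) (chart_trans c c')"
    by (rule smooth_on_chart_trans[OF smooth_atlas adapted_max_atlas[OF c] c'])
  have i: "snd c (\<gamma> t) \<in> snd c ` (fst c \<inter> fst c')" using p by blast
  note h = smooth_on_has_derivative[OF sm i]
  have "((\<lambda>s. snd c (\<gamma> s)) has_derivative (\<lambda>h. h *\<^sub>R ?D)) (at t)"
    using adapted_section_derivative[OF \<gamma> c p(1)] by (simp add: has_vector_derivative_def)
  from has_derivative_compose[OF this h]
  have d: "((\<lambda>s. chart_trans c c' (snd c (\<gamma> s))) has_derivative
      (\<lambda>h. fd (chart_trans c c') (snd c (\<gamma> t)) (h *\<^sub>R ?D))) (at t)" .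
  obtain I where I: "open I" "t \<in> I" "\<And>s. s \<in> I \<Longrightarrow> \<gamma> s \<in> fst c"
    using local_section_near[OF \<gamma> is_chart_open[OF adapted_is_chart[OF c]] p(1)] by blast
  have "((\<lambda>s. snd c' (\<gamma> s)) has_derivative
      (\<lambda>h. fd (chart_trans c c') (snd c (\<gamma> t)) (h *\<^sub>R ?D))) (at t)"
    by (rule has_derivative_cong_open[OF d I(1,2)]) (simp add: I(3) chart_trans_apply adapted_is_chart[OF c])
  then show ?thesis
    unfolding linear_cmul[OF smooth_on_linear_fd[OF sm i]] by (simp add: has_vector_derivative_def)
qed

text \<open>The representative picked by the choice operator in \<open>jet_proj\<close> and
  \<open>jet_coords\<close> generates the same class, since \<open>same_jet\<close> is symmetric and
  transitive.\<close>

lemma J1_representative: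
  assumes "j \<in> J1 F"
  obtains t \<gamma> where "(SOME r. r \<in> j) = (t, \<gamma>)" "local_section F t \<gamma>" "j = jet1 F t \<gamma>"
proof -
  obtain t \<gamma> where j: "j = jet1 F t \<gamma>" "local_section F t \<gamma>" using assms by (auto simp: J1_def)
  have "(t, \<gamma>) \<in> j" using j by (simp add: jet1_def same_jet_def)
  then have "(SOME r. r \<in> j) \<in> j" by (rule someI)
  then obtain \<gamma>' where r: "(SOME r. r \<in> j) = (t, \<gamma>')" "local_section F t \<gamma>'" "same_jet F t \<gamma> \<gamma>'"
    unfolding j(1) jet1_def by blast
  have "jet1 F t \<gamma> = jet1 F t \<gamma>'"
    using r(3) unfolding jet1_def same_jet_def by (auto split: prod.splits; metis)
  then show thesis using that r j by metis
qed

lemma jet_coords_base: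
  assumes c: "c \<in> adapted F" and j: "j \<in> jet_dom F c"
  shows "(fst (jet_coords c j), fst (snd (jet_coords c j))) = snd c (jet_proj j)"
proof -
  from j have "j \<in> J1 F" by (simp add: jet_dom_def)
  then obtain t \<gamma> where r: "(SOME r. r \<in> j) = (t, \<gamma>)" "local_section F t \<gamma>" by (rule J1_representative)
  have "fst (snd c (\<gamma> t)) = t"
    using j r adapted_fst[OF c] proj_local_section[OF r(2)] by (simp add: jet_dom_def jet_proj_def)
  then show ?thesis unfolding jet_coords_def jet_proj_def r(1) by (simp add: prod_eq_iff)
qed

text \<open>Equal coordinates give the same base point and the same velocity in \<open>c\<close>;
  the chain rule then gives equal velocities in every atlas chart around that point, hence the same
  jet.\<close>

lemma inj_on_jet_coords:
  assumes c: "c \<in> adapted F"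
  shows "inj_on (jet_coords c) (jet_dom F c)"
proof (rule inj_onI)
  fix j1 j2 assume j1: "j1 \<in> jet_dom F c" and j2: "j2 \<in> jet_dom F c" and eq: "jet_coords c j1 = jet_coords c j2"
  from j1 have "j1 \<in> J1 F" by (simp add: jet_dom_def)
  then obtain t \<gamma> where r: "(SOME r. r \<in> j1) = (t, \<gamma>)" "local_section F t \<gamma>" "j1 = jet1 F t \<gamma>"
    by (rule J1_representative)
  from j2 have "j2 \<in> J1 F" by (simp add: jet_dom_def)
  then obtain t' \<gamma>' where r': "(SOME r. r \<in> j2) = (t', \<gamma>')" "local_section F t' \<gamma>'" "j2 = jet1 F t' \<gamma>'"
    by (rule J1_representative)
  have t: "t' = t" using eq r r' by (simp add: jet_coords_def)
  have "snd c (jet_proj j1) = snd c (jet_proj j2)"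
    using eq jet_coords_base[OF c j1] jet_coords_base[OF c j2] by simp
  then have "jet_proj j1 = jet_proj j2"
    using is_chart_inj[OF adapted_is_chart[OF c]] j1 j2 by (auto simp: jet_dom_def inj_on_def)
  then have g: "\<gamma>' t = \<gamma> t" using r r' t by (simp add: jet_proj_def)
  have p: "\<gamma> t \<in> fst c" using j1 r by (simp add: jet_dom_def jet_proj_def)
  have y: "vector_derivative (\<lambda>s. snd (snd c (\<gamma> s))) (at t) = vector_derivative (\<lambda>s. snd (snd c (\<gamma>' s))) (at t)"
    using eq r r' t by (simp add: jet_coords_def)
  have same: "vector_derivative (snd a \<circ> \<gamma>) (at t) = vector_derivative (snd a \<circ> \<gamma>') (at t)"
    if a: "a \<in> atlas F" "\<gamma> t \<in> fst a" for a
  proof -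
    have am: "a \<in> max_atlas (atlas F)" using a atlas_subset_max_atlas[OF smooth_atlas] by blast
    show ?thesis
      using section_transition[OF r(2) c am p a(2)] section_transition[of t \<gamma>' c a] r'(2) t c am p a(2) g y
      by (simp add: o_def vector_derivative_at)
  qed
  have "same_jet F t \<gamma> \<gamma>'" unfolding same_jet_def using g same by auto
  then have "jet1 F t \<gamma> = jet1 F t \<gamma>'" unfolding jet1_def same_jet_def by (auto split: prod.splits; metis)
  then show "j1 = j2" using r r' t by simp
qed

lemma jet_point_coords: "c \<in> adapted F \<Longrightarrow> j \<in> jet_dom F c \<Longrightarrow> jet_point F c (jet_coords c j) = j"
  by (simp add: jet_point_def inv_into_f_f inj_on_jet_coords)

lemma open_jet_chart_dom:
  assumes "is_chart c" "is_chart c'"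
  shows "open (jet_chart_dom c c')"
proof -
  have "open (snd c ` (fst c \<inter> fst c'))"
    using assms by (auto intro!: is_chart_open_image open_Int is_chart_open)
  moreover have "jet_chart_dom c c' = (\<lambda>x. (fst x, fst (snd x))) -` (snd c ` (fst c \<inter> fst c'))"
    by (auto simp: jet_chart_dom_def)
  ultimately show ?thesis by (auto intro!: open_vimage continuous_intros)
qed

lemma jet_coords_in_chart_dom:
  assumes c: "c \<in> adapted F" and c': "c' \<in> adapted F" and j: "j \<in> jet_dom F c"
  shows "jet_coords c j \<in> jet_chart_dom c c' \<longleftrightarrow> j \<in> jet_dom F c'"
proof -
  have "snd c (jet_proj j) \<in> snd c ` (fst c \<inter> fst c') \<longleftrightarrow> jet_proj j \<in> fst c'"
    using j is_chart_inj[OF adapted_is_chart[OF c]] by (auto simp: jet_dom_def inj_on_def)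
  then show ?thesis using jet_coords_base[OF c j] j by (simp add: jet_chart_dom_def jet_dom_def)
qed

lemma jet_coords_trans:
  assumes c: "c \<in> adapted F" and c': "c' \<in> adapted F" and j: "j \<in> jet_dom F c" "j \<in> jet_dom F c'"
  shows "jet_coords c' j = jet_chart_trans c c' (jet_coords c j)"
proof -
  from j have "j \<in> J1 F" by (simp add: jet_dom_def)
  then obtain t \<gamma> where r: "(SOME r. r \<in> j) = (t, \<gamma>)" "local_section F t \<gamma>" by (rule J1_representative)
  have p: "\<gamma> t \<in> fst c" "\<gamma> t \<in> fst c'" using j r by (auto simp: jet_dom_def jet_proj_def)
  have b: "(t, snd (snd c (\<gamma> t))) = snd c (\<gamma> t)"
    using jet_coords_base[OF c j(1)] r by (simp add: jet_coords_def jet_proj_def)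
  have "((\<lambda>s. snd c' (\<gamma> s)) has_vector_derivative fd (chart_trans c c') (snd c (\<gamma> t))
    (1, vector_derivative (\<lambda>s. snd (snd c (\<gamma> s))) (at t))) (at t)"
    by (rule section_transition[OF r(2) c adapted_max_atlas[OF c'] p])
  then have "((\<lambda>s. snd (snd c' (\<gamma> s))) has_vector_derivative snd (fd (chart_trans c c') (snd c (\<gamma> t))
    (1, vector_derivative (\<lambda>s. snd (snd c (\<gamma> s))) (at t)))) (at t)"
    unfolding has_vector_derivative_def by (auto dest: has_derivative_snd)
  then have "vector_derivative (\<lambda>s. snd (snd c' (\<gamma> s))) (at t) = snd (fd (chart_trans c c') (snd c (\<gamma> t))
    (1, vector_derivative (\<lambda>s. snd (snd c (\<gamma> s))) (at t)))"
    by (rule vector_derivative_at)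
  then show ?thesis
    using r chart_trans_apply[OF adapted_is_chart[OF c] p(1), of c'] b
    by (simp add: jet_coords_def jet_chart_trans_def)
qed

section \<open>Coordinate changes on the jet bundle\<close>

context
  fixes c c' assumes c: "c \<in> adapted F" and c': "c' \<in> adapted F"
begin

lemma smooth_on_chart_trans_adapted: "smooth_on (snd c ` (fst c \<inter> fst c')) (chart_trans c c')"
  by (rule smooth_on_chart_trans[OF smooth_atlas adapted_max_atlas[OF c] adapted_max_atlas[OF c']])

lemma smooth_on_jet_chart_trans: "smooth_on (jet_chart_dom c c') (jet_chart_trans c c')"
proof -
  let ?U = "jet_chart_dom c c'" and ?V = "snd c ` (fst c \<inter> fst c')"
  let ?q = "\<lambda>x::'n jspace. (fst x, fst (snd x))"
  have U: "open ?U" by (rule open_jet_chart_dom[OF adapted_is_chart[OF c] adapted_is_chart[OF c']])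
  have V: "open ?V"
    using adapted_is_chart[OF c] adapted_is_chart[OF c']
    by (auto intro!: is_chart_open_image open_Int is_chart_open)
  have blq: "bounded_linear ?q"
    by (intro bounded_linear_Pair bounded_linear_fst bounded_linear_compose[OF bounded_linear_fst bounded_linear_snd])
  have sub: "?q ` ?U \<subseteq> ?V" by (auto simp: jet_chart_dom_def)
  note q = smooth_on_bounded_linear[OF blq, of ?U]
  have f: "smooth_on ?U fst" by (rule smooth_on_bounded_linear[OF bounded_linear_fst])
  have X: "smooth_on ?U (\<lambda>x. (1::real, snd (snd x)))"
    by (intro smooth_on_Pair U smooth_on_const smooth_on_bounded_linear
        bounded_linear_compose[OF bounded_linear_snd bounded_linear_snd])
  show ?thesis
    unfolding jet_chart_trans_def[abs_def]
    by (intro smooth_on_Pair U f smooth_on_bounded_linear_compose[OF bounded_linear_snd]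
        smooth_on_compose[OF U V sub q smooth_on_chart_trans_adapted]
        smooth_on_fd_apply[OF U V sub q smooth_on_chart_trans_adapted X])
qed

context
  fixes x assumes x: "x \<in> jet_chart_dom c c'"
begin

abbreviation (input) "Dtau \<equiv> fd (chart_trans c c') (fst x, fst (snd x))"

lemma base_mem: "(fst x, fst (snd x)) \<in> snd c ` (fst c \<inter> fst c')"
  using x by (simp add: jet_chart_dom_def)

lemma linear_Dtau: "linear Dtau"
  by (rule smooth_on_linear_fd[OF smooth_on_chart_trans_adapted base_mem])

lemma fst_fd_jet_chart_trans: "fst (fd (jet_chart_trans c c') x v) = fst v"
proof -
  have "((\<lambda>x. fst (jet_chart_trans c c' x)) has_derivative (\<lambda>v. fst (fd (jet_chart_trans c c') x v))) (at x)"
    by (rule has_derivative_fst[OF smooth_on_has_derivative[OF smooth_on_jet_chart_trans x]])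
  moreover have "((\<lambda>x. fst (jet_chart_trans c c' x)) has_derivative fst) (at x)"
    using has_derivative_fst[OF has_derivative_ident] by (simp add: jet_chart_trans_def)
  ultimately show ?thesis by (rule has_derivative_unique[THEN fun_cong])
qed

lemma fst_snd_fd_jet_chart_trans:
  "fst (snd (fd (jet_chart_trans c c') x v)) = snd (Dtau (fst v, fst (snd v)))"
proof -
  have "((\<lambda>x. fst (snd (jet_chart_trans c c' x))) has_derivative
      (\<lambda>v. fst (snd (fd (jet_chart_trans c c') x v)))) (at x)"
    by (rule has_derivative_fst[OF has_derivative_snd[OF smooth_on_has_derivative[OF smooth_on_jet_chart_trans x]]])
  moreover have "((\<lambda>x. fst (snd (jet_chart_trans c c' x))) has_derivative
      (\<lambda>v. snd (Dtau (fst v, fst (snd v))))) (at x)"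
  proof -
    have "((\<lambda>x::'n jspace. (fst x, fst (snd x))) has_derivative (\<lambda>v. (fst v, fst (snd v)))) (at x)"
      by (auto intro!: derivative_eq_intros)
    from has_derivative_snd[OF has_derivative_compose[OF this
          smooth_on_has_derivative[OF smooth_on_chart_trans_adapted base_mem]]]
    show ?thesis by (simp add: jet_chart_trans_def)
  qed
  ultimately show ?thesis by (rule has_derivative_unique[THEN fun_cong])
qed

text \<open>Over a fixed base point the transition is affine in \<open>y\<close>, so its derivative
  along the fibre is the linear part and can be read off along a line.\<close>

lemma fd_jet_chart_trans_vertical:
  "fd (jet_chart_trans c c') x (0, 0, u) = (0, 0, snd (Dtau (0, u)))"
proof -
  let ?T = "jet_chart_trans c c'"
  have T: "?T (x + s *\<^sub>R (0, 0, u)) = ?T x + s *\<^sub>R (0, 0, snd (Dtau (0, u)))" for s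
  proof -
    have "(1::real, snd (snd x) + s *\<^sub>R u) = (1, snd (snd x)) + s *\<^sub>R (0, u)" by simp
    then have "Dtau (1, snd (snd x) + s *\<^sub>R u) = Dtau (1, snd (snd x)) + s *\<^sub>R Dtau (0, u)"
      by (simp only: linear_add[OF linear_Dtau] linear_cmul[OF linear_Dtau])
    then show ?thesis by (simp add: jet_chart_trans_def)
  qed
  have l: "((\<lambda>s. x + s *\<^sub>R (0, 0, u)) has_derivative (\<lambda>h. h *\<^sub>R (0, 0, u))) (at 0)"
    by (auto intro!: derivative_eq_intros)
  have "(?T has_derivative fd ?T x) (at (x + 0 *\<^sub>R (0, 0, u)))"
    using smooth_on_has_derivative[OF smooth_on_jet_chart_trans x] by (simp flip: zero_prod_def)
  from has_derivative_compose[OF l this]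
  have "((\<lambda>s. ?T x + s *\<^sub>R (0, 0, snd (Dtau (0, u)))) has_derivative (\<lambda>h. fd ?T x (h *\<^sub>R (0, 0, u)))) (at 0)"
    by (simp only: T)
  moreover have "((\<lambda>s. ?T x + s *\<^sub>R (0, 0, snd (Dtau (0, u)))) has_derivative
      (\<lambda>h. h *\<^sub>R (0, 0, snd (Dtau (0, u))))) (at 0)"
    by (auto intro!: derivative_eq_intros)
  ultimately have "fd ?T x (1 *\<^sub>R (0, 0, u)) = 1 *\<^sub>R (0, 0, snd (Dtau (0, u)))"
    by (rule has_derivative_unique[THEN fun_cong])
  then show ?thesis by simp
qed

text \<open>Invariance of J under coordinate changes: (0, b - a y) is (a, b) - a (1, y), and the
  derivative of the change of charts is linear.\<close>

lemma vert_fd_jet_chart_trans: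
  "vert (jet_chart_trans c c' x) (fd (jet_chart_trans c c') x v) = fd (jet_chart_trans c c') x (vert x v)"
proof -
  have "(0, fst (snd v) - fst v *\<^sub>R snd (snd x)) = (fst v, fst (snd v)) - fst v *\<^sub>R (1, snd (snd x))"
    by simp
  then have "Dtau (0, fst (snd v) - fst v *\<^sub>R snd (snd x)) =
      Dtau (fst v, fst (snd v)) - fst v *\<^sub>R Dtau (1, snd (snd x))"
    by (simp only: linear_diff[OF linear_Dtau] linear_cmul[OF linear_Dtau])
  then have "snd (Dtau (0, fst (snd v) - fst v *\<^sub>R snd (snd x))) =
      snd (Dtau (fst v, fst (snd v))) - fst v *\<^sub>R snd (Dtau (1, snd (snd x)))"
    by simp
  then show ?thesis
    using fd_jet_chart_trans_vertical[of "fst (snd v) - fst v *\<^sub>R snd (snd x)"]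
    by (simp add: vert_def fst_fd_jet_chart_trans fst_snd_fd_jet_chart_trans) (simp add: jet_chart_trans_def)
qed

end

end

section \<open>Coordinate images of sets of jets\<close>

lemma jet_open_img: "jet_open F W \<Longrightarrow> c \<in> adapted F \<Longrightarrow> open (jet_img F W c)"
  by (simp add: jet_open_def)

lemma jet_img_iff:
  assumes "c \<in> adapted F"
  shows "x \<in> jet_img F W c \<longleftrightarrow> jet_point F c x \<in> W \<and> jet_point F c x \<in> jet_dom F c \<and>
    jet_coords c (jet_point F c x) = x"
proof
  assume "x \<in> jet_img F W c"
  then show "jet_point F c x \<in> W \<and> jet_point F c x \<in> jet_dom F c \<and> jet_coords c (jet_point F c x) = x"
    using jet_point_coords[OF assms] by (auto simp: jet_img_def)
next
  assume "jet_point F c x \<in> W \<and> jet_point F c x \<in> jet_dom F c \<and> jet_coords c (jet_point F c x) = x"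
  then show "x \<in> jet_img F W c" unfolding jet_img_def by (metis IntI image_eqI)
qed

lemma jet_point_trans:
  assumes "c \<in> adapted F" "c' \<in> adapted F" "x \<in> jet_img F W c" "x \<in> jet_chart_dom c c'"
  shows "jet_chart_trans c c' x \<in> jet_img F W c'"
    "jet_point F c' (jet_chart_trans c c' x) = jet_point F c x"
proof -
  let ?j = "jet_point F c x"
  have j: "?j \<in> W" "?j \<in> jet_dom F c" "jet_coords c ?j = x" using assms by (auto simp: jet_img_iff)
  have j': "?j \<in> jet_dom F c'" using jet_coords_in_chart_dom[OF assms(1,2) j(2)] j(3) assms(4) by simp
  have e: "jet_coords c' ?j = jet_chart_trans c c' x" using jet_coords_trans[OF assms(1,2) j(2) j'] j(3) by simp
  show "jet_chart_trans c c' x \<in> jet_img F W c'" using j j' e unfolding jet_img_def by (metis IntI image_eqI)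
  show "jet_point F c' (jet_chart_trans c c' x) = jet_point F c x"
    using jet_point_coords[OF assms(2) j'] e by simp
qed

text \<open>The composite in \<open>jet_trans\<close> runs through the inverse
  \<open>jet_point\<close>, which is controlled on coordinate images of jets. Openness of
  \<open>W\<close> provides a neighbourhood on which it agrees with the explicit transition.\<close>

lemma jet_trans_eq:
  assumes W: "jet_open F W" and c: "c \<in> adapted F" and c': "c' \<in> adapted F"
    and j: "j \<in> W" "j \<in> jet_dom F c" "j \<in> jet_dom F c'"
  shows "jet_trans F c c' j = fd (jet_chart_trans c c') (jet_coords c j)"
  unfolding jet_trans_def
proof (rule fd_cong_open)
  show "open (jet_img F W c \<inter> jet_chart_dom c c')"
    by (intro open_Int jet_open_img[OF W c] open_jet_chart_dom adapted_is_chart c c')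
  show "jet_coords c j \<in> jet_img F W c \<inter> jet_chart_dom c c'"
    using j jet_coords_in_chart_dom[OF c c' j(2)] by (auto simp: jet_img_def)
  fix x assume x: "x \<in> jet_img F W c \<inter> jet_chart_dom c c'"
  then have "jet_chart_trans c c' x \<in> jet_img F W c'"
    "jet_point F c' (jet_chart_trans c c' x) = jet_point F c x"
    using jet_point_trans[OF c c', of x W] by simp_all
  then show "(jet_coords c' \<circ> jet_point F c) x = jet_chart_trans c c' x"
    using jet_img_iff[OF c'] by (metis comp_apply)
qed

end

section \<open>Forms on the jet bundle in a chart\<close>

lemma ext_d_0: "ext_d \<omega> c x [v] = fd (\<lambda>z. \<omega> c z []) x v"
  by (simp add: ext_d_def omit_def)

lemma ext_d_1: "ext_d \<omega> c x [v, w] = ext_d1 (\<lambda>x v. \<omega> c x [v]) x v w"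
  by (simp add: ext_d_def ext_d1_def omit_def lessThan_Suc numeral_2_eq_2)

lemma vert_endo_eq: "vert_endo c x v = vert x v"
  by (cases x; cases v) (simp add: vert_endo_def vert_def)

lemma wedge1_dt: "wedge1 \<omega> dt c x [v, w] = \<omega> c x [v] * fst w - \<omega> c x [w] * fst v"
  by (simp add: wedge1_def dt_def omit_def lessThan_Suc)

lemma lie_0: "lie X \<omega> c x [] = fd (\<lambda>z. \<omega> c z []) x (X c x)"
  by (simp add: lie_def)

lemma lie_1: "lie X \<omega> c x [v] = fd (\<lambda>z. \<omega> c z [v]) x (X c x) + \<omega> c x [fd (X c) x v]"
  by (simp add: lie_def)

lemma lie_ext_d_1:
  "lie X (ext_d \<omega>) c x [v, w] = fd (\<lambda>z. ext_d1 (\<lambda>x v. \<omega> c x [v]) z v w) x (X c x) +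
    ext_d1 (\<lambda>x v. \<omega> c x [v]) x (fd (X c) x v) w + ext_d1 (\<lambda>x v. \<omega> c x [v]) x v (fd (X c) x w)"
  by (simp add: lie_def ext_d_1 lessThan_Suc)

lemma d_J_1:
  "d_J \<omega> c x [v, w] = ext_d1 (\<lambda>x v. \<omega> c x [v]) x (vert x v) w + ext_d1 (\<lambda>x v. \<omega> c x [v]) x v (vert x w)
    - ext_d1 (\<lambda>z u. \<omega> c z [vert z u]) x v w"
  by (simp add: d_endo_def ins_def ext_d_1 vert_endo_eq lessThan_Suc)

text \<open>Contraction of a function with J is an empty sum, so only i_J dL is left of
  \<open>d_J L\<close>.\<close>

lemma poincare_cartan_apply: "poincare_cartan F L c x [v] = pc (\<lambda>z. L (jet_point F c z)) x v"
  by (simp add: poincare_cartan_def pc_def fmult_def fn_def dt_def d_endo_def ins_def ext_d_0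
      vert_endo_eq frechet_derivative_const)

lemma fmult_dt_apply: "fmult (fn F f) dt c x [v] = f (jet_point F c x) * fst v"
  by (simp add: fmult_def fn_def dt_def)

lemma form_eq_0: "form_eq F 0 W \<alpha> \<beta> \<longleftrightarrow> (\<forall>c\<in>adapted F. \<forall>x\<in>jet_img F W c. \<alpha> c x [] = \<beta> c x [])"
  by (simp add: form_eq_def)

lemma all_length_1_iff: "(\<forall>vs. length vs = 1 \<longrightarrow> P vs) \<longleftrightarrow> (\<forall>v. P [v])"
  by (auto simp: length_Suc_conv)

lemma all_length_2_iff: "(\<forall>vs. length vs = 2 \<longrightarrow> P vs) \<longleftrightarrow> (\<forall>v w. P [v, w])"
  by (auto simp: length_Suc_conv numeral_2_eq_2)

lemma form_eq_length_1:
  "form_eq F 1 W \<alpha> \<beta> \<longleftrightarrow> (\<forall>c\<in>adapted F. \<forall>x\<in>jet_img F W c. \<forall>v. \<alpha> c x [v] = \<beta> c x [v])"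
  by (simp only: form_eq_def all_length_1_iff)

lemmas form_eq_1 = form_eq_length_1 form_eq_length_1[unfolded One_nat_def]

lemma form_eq_2:
  "form_eq F 2 W \<alpha> \<beta> \<longleftrightarrow> (\<forall>c\<in>adapted F. \<forall>x\<in>jet_img F W c. \<forall>v w. \<alpha> c x [v, w] = \<beta> c x [v, w])"
  by (simp only: form_eq_def all_length_2_iff)

lemma form_rank_cong: "(\<And>v w. \<alpha> c x [v, w] = \<beta> c x [v, w]) \<Longrightarrow> form_rank \<alpha> c x = form_rank \<beta> c x"
  by (simp add: form_rank_def)

lemma jet_img_mono: "V \<subseteq> W \<Longrightarrow> jet_img F V c \<subseteq> jet_img F W c"
  by (auto simp: jet_img_def)

lemma form_eq_subset: "form_eq F k W \<alpha> \<beta> \<Longrightarrow> V \<subseteq> W \<Longrightarrow> form_eq F k V \<alpha> \<beta>"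
  unfolding form_eq_def using jet_img_mono by blast

lemma one_form_subset: "one_form F W \<theta> \<Longrightarrow> V \<subseteq> W \<Longrightarrow> one_form F V \<theta>"
  unfolding one_form_def
  by (intro conjI ballI allI) (blast dest: jet_img_mono[THEN subsetD] intro: smooth_on_subset[OF _ jet_img_mono])+

lemma semi_basic_subset: "semi_basic F W \<theta> \<Longrightarrow> V \<subseteq> W \<Longrightarrow> semi_basic F V \<theta>"
  unfolding semi_basic_def using jet_img_mono by blast

lemma smooth_fn_subset: "smooth_fn F W f \<Longrightarrow> V \<subseteq> W \<Longrightarrow> smooth_fn F V f"
  unfolding smooth_fn_def by (auto intro: smooth_on_subset[OF _ jet_img_mono])

lemma Lambda1_subset: "\<theta> \<in> Lambda1 F S W \<Longrightarrow> V \<subseteq> W \<Longrightarrow> \<theta> \<in> Lambda1 F S V"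
  unfolding Lambda1_def nondegenerate_def has_rank_def
  by (auto intro: one_form_subset semi_basic_subset form_eq_subset dest: jet_img_mono[THEN subsetD])

lemma pc_cong_open:
  assumes "open U" "x \<in> U" "\<And>z. z \<in> U \<Longrightarrow> f z = g z"
  shows "pc f x v = pc g x v"
  using fd_cong_open[OF assms] assms(2,3) by (simp add: pc_def)

section \<open>Passage from charts to the jet bundle\<close>

locale fibred_spray = fibred F
  for F :: "('m::{t2_space, second_countable_topology}, 'n::finite) fibration" +
  fixes S :: "('m, 'n) jvec"
  assumes semispray: "semispray F S"
begin

lemma spray_chart:
  assumes W: "jet_open F W" and c: "c \<in> adapted F"
  shows "spray_chart (jet_img F W c) (S c)"
proof
  have sub: "jet_img F W c \<subseteq> jet_img F (J1 F) c" using W by (intro jet_img_mono) (simp add: jet_open_def)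
  show "open (jet_img F W c)" by (rule jet_open_img[OF W c])
  show "smooth_on (jet_img F W c) (S c)"
    using semispray c sub smooth_on_subset unfolding semispray_def vector_field_def by blast
  fix x assume "x \<in> jet_img F W c"
  then have "vert_endo c x (S c x) = 0" "dt c x [S c x] = 1"
    using semispray c sub by (auto simp: semispray_def)
  then show "fst (S c x) = 1" "fst (snd (S c x)) = snd (snd x)"
    by (simp_all add: vert_endo_eq vert_def dt_def zero_prod_def)
qed

lemma one_form_on_chart:
  "one_form F W \<theta> \<Longrightarrow> c \<in> adapted F \<Longrightarrow> one_form_on (jet_img F W c) (\<lambda>x v. \<theta> c x [v])"
  by (simp add: one_form_def one_form_on_def)

lemma smooth_fn_chart:
  "smooth_fn F W f \<Longrightarrow> c \<in> adapted F \<Longrightarrow> smooth_on (jet_img F W c) (\<lambda>z. f (jet_point F c z))"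
  by (simp add: smooth_fn_def o_def)

lemma semi_basic_on_chart:
  "semi_basic F W \<theta> \<Longrightarrow> c \<in> adapted F \<Longrightarrow> semi_basic_on (jet_img F W c) (\<lambda>x v. \<theta> c x [v])"
  by (simp add: semi_basic_def semi_basic_on_def)

lemma first_integral_chart:
  "first_integral F S W f \<Longrightarrow> c \<in> adapted F \<Longrightarrow> x \<in> jet_img F W c \<Longrightarrow>
    fd (\<lambda>z. f (jet_point F c z)) x (S c x) = 0"
  by (simp add: first_integral_def form_eq_0 lie_0 fn_def)

context
  fixes W assumes W: "jet_open F W"
begin

context
  fixes c c' x
  assumes c: "c \<in> adapted F" and c': "c' \<in> adapted F"
    and x: "x \<in> jet_img F W c" "x \<in> jet_chart_dom c c'"
begin

lemma jet_trans_at: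
  "jet_point F c x \<in> W \<inter> jet_dom F c \<inter> jet_dom F c'" "jet_coords c (jet_point F c x) = x"
  "jet_coords c' (jet_point F c x) = jet_chart_trans c c' x"
  "jet_trans F c c' (jet_point F c x) = fd (jet_chart_trans c c') x"
proof -
  let ?j = "jet_point F c x"
  have j: "?j \<in> W" "?j \<in> jet_dom F c" "jet_coords c ?j = x" using x c by (auto simp: jet_img_iff)
  then have j': "?j \<in> jet_dom F c'" using jet_coords_in_chart_dom[OF c c' j(2)] x by simp
  show "?j \<in> W \<inter> jet_dom F c \<inter> jet_dom F c'" using j j' by simp
  show "jet_coords c ?j = x" by (rule j)
  show "jet_coords c' ?j = jet_chart_trans c c' x" using jet_coords_trans[OF c c' j(2) j'] j by simp
  show "jet_trans F c c' ?j = fd (jet_chart_trans c c') x" using jet_trans_eq[OF W c c' j(1,2) j'] j by simp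
qed

lemma S_trans: "S c' (jet_chart_trans c c' x) = fd (jet_chart_trans c c') x (S c x)"
proof -
  have "jet_point F c x \<in> J1 F \<inter> jet_dom F c \<inter> jet_dom F c'"
    using jet_trans_at(1) by (auto simp: jet_dom_def)
  then have "S c' (jet_coords c' (jet_point F c x)) =
      jet_trans F c c' (jet_point F c x) (S c (jet_coords c (jet_point F c x)))"
    using semispray c c' unfolding semispray_def vector_field_def by blast
  then show ?thesis by (simp add: jet_trans_at)
qed

lemma one_form_trans:
  assumes "one_form F W \<theta>"
  shows "\<theta> c' (jet_chart_trans c c' x) [fd (jet_chart_trans c c') x v] = \<theta> c x [v]"
proof -
  have "\<theta> c' (jet_coords c' (jet_point F c x)) [jet_trans F c c' (jet_point F c x) v] =
      \<theta> c (jet_coords c (jet_point F c x)) [v]"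
    using assms c c' jet_trans_at(1) unfolding one_form_def by blast
  then show ?thesis by (simp add: jet_trans_at)
qed

lemma fd_fn_trans:
  assumes f: "smooth_fn F W f"
  shows "fd (\<lambda>z. f (jet_point F c z)) x v =
    fd (\<lambda>z. f (jet_point F c' z)) (jet_chart_trans c c' x) (fd (jet_chart_trans c c') x v)"
proof -
  let ?T = "jet_chart_trans c c'"
  have "(?T has_derivative fd ?T x) (at x)"
    by (rule smooth_on_has_derivative[OF smooth_on_jet_chart_trans[OF c c'] x(2)])
  from has_derivative_compose[OF this smooth_on_has_derivative[OF smooth_fn_chart[OF f c'] jet_point_trans(1)[OF c c' x]]]
  have "((\<lambda>z. f (jet_point F c' (?T z))) has_derivative
      (\<lambda>v. fd (\<lambda>z. f (jet_point F c' z)) (?T x) (fd ?T x v))) (at x)" .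
  then have "((\<lambda>z. f (jet_point F c z)) has_derivative
      (\<lambda>v. fd (\<lambda>z. f (jet_point F c' z)) (?T x) (fd ?T x v))) (at x)"
  proof (rule has_derivative_cong_open)
    show "open (jet_img F W c \<inter> jet_chart_dom c c')"
      by (intro open_Int jet_open_img[OF W c] open_jet_chart_dom adapted_is_chart c c')
    show "x \<in> jet_img F W c \<inter> jet_chart_dom c c'" using x by simp
    show "f (jet_point F c' (?T z)) = f (jet_point F c z)" if "z \<in> jet_img F W c \<inter> jet_chart_dom c c'" for z
      using jet_point_trans(2)[OF c c', of z W] that by simp
  qed
  then show ?thesis by (simp add: fd_unique)
qed

end

text \<open>Moves the transformation law from jets to coordinate points, where the explicit
  transition can be computed with.\<close>

lemma one_formI:
  assumes "\<And>c. c \<in> adapted F \<Longrightarrow> one_form_on (jet_img F W c) (\<lambda>x v. \<theta> c x [v])"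
    and "\<And>c c' x v. c \<in> adapted F \<Longrightarrow> c' \<in> adapted F \<Longrightarrow> x \<in> jet_img F W c \<Longrightarrow> x \<in> jet_chart_dom c c' \<Longrightarrow>
      \<theta> c' (jet_chart_trans c c' x) [fd (jet_chart_trans c c') x v] = \<theta> c x [v]"
  shows "one_form F W \<theta>"
  unfolding one_form_def
proof (intro conjI ballI allI)
  fix c assume c: "c \<in> adapted F"
  show "linear (\<lambda>v. \<theta> c x [v])" if "x \<in> jet_img F W c" for x
    using assms(1)[OF c] that by (simp add: one_form_on_def)
  show "smooth_on (jet_img F W c) (\<lambda>x. \<theta> c x [v])" for v
    using one_form_on_smooth[OF assms(1)[OF c]] .
next
  fix c c' j v assume c: "c \<in> adapted F" and c': "c' \<in> adapted F" and j: "j \<in> W \<inter> jet_dom F c \<inter> jet_dom F c'"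
  let ?x = "jet_coords c j"
  have x: "?x \<in> jet_img F W c" "?x \<in> jet_chart_dom c c'"
    using j jet_coords_in_chart_dom[OF c c'] by (auto simp: jet_img_def)
  have "jet_point F c ?x = j" using jet_point_coords[OF c] j by blast
  then show "\<theta> c' (jet_coords c' j) [jet_trans F c c' j v] = \<theta> c (jet_coords c j) [v]"
    using assms(2)[OF c c' x, of v] jet_trans_at[OF c c' x] by simp
qed

text \<open>The transition preserves dt, commutes with J and respects differentials of functions on
  jets, so the chart formulas fit together.\<close>

lemma one_form_poincare_cartan_plus:
  assumes L: "smooth_fn F W L" and f: "smooth_fn F W f"
  shows "one_form F W (poincare_cartan F L + fmult (fn F f) dt)"
proof (rule one_formI)
  fix c assume c: "c \<in> adapted F"
  note U = jet_open_img[OF W c]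
  show "one_form_on (jet_img F W c) (\<lambda>x v. (poincare_cartan F L + fmult (fn F f) dt) c x [v])"
    using one_form_on_add[OF U one_form_on_pc[OF U smooth_fn_chart[OF L c]]
        one_form_on_mult_dt[OF U smooth_fn_chart[OF f c]]]
    by (simp add: poincare_cartan_apply fmult_dt_apply)
next
  fix c c' x v
  assume a: "c \<in> adapted F" "c' \<in> adapted F" "x \<in> jet_img F W c" "x \<in> jet_chart_dom c c'"
  show "(poincare_cartan F L + fmult (fn F f) dt) c' (jet_chart_trans c c' x) [fd (jet_chart_trans c c') x v] =
      (poincare_cartan F L + fmult (fn F f) dt) c x [v]"
    using fd_fn_trans[OF a L, of "vert x v"] jet_point_trans(2)[OF a]
    by (simp add: poincare_cartan_apply fmult_dt_apply pc_def vert_fd_jet_chart_trans[OF a(1,2,4)]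
        fst_fd_jet_chart_trans[OF a(1,2,4)])
qed

text \<open>Invariant values in charts come from a single function on jets: each jet is evaluated in
  one chosen adapted chart around it.\<close>

lemma glue_scalar:
  assumes "\<And>c c' x. c \<in> adapted F \<Longrightarrow> c' \<in> adapted F \<Longrightarrow> x \<in> jet_img F W c \<Longrightarrow> x \<in> jet_chart_dom c c' \<Longrightarrow>
    g c' (jet_chart_trans c c' x) = g c x"
  shows "\<exists>h. \<forall>c\<in>adapted F. \<forall>x\<in>jet_img F W c. h (jet_point F c x) = (g c x :: real)"
proof -
  define ch where "ch j = (SOME c. c \<in> adapted F \<and> j \<in> jet_dom F c)" for j
  have "g (ch j) (jet_coords (ch j) j) = g c x"
    if c: "c \<in> adapted F" and x: "x \<in> jet_img F W c" and j: "j = jet_point F c x" for c x j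
  proof -
    have jc: "j \<in> W" "j \<in> jet_dom F c" "jet_coords c j = x" using x c j by (auto simp: jet_img_iff)
    then have "ch j \<in> adapted F \<and> j \<in> jet_dom F (ch j)"
      unfolding ch_def using c by (intro someI[of "\<lambda>c. c \<in> adapted F \<and> j \<in> jet_dom F c"]) simp
    then have c': "ch j \<in> adapted F" "j \<in> jet_dom F (ch j)" by auto
    have "x \<in> jet_chart_dom c (ch j)" using jet_coords_in_chart_dom[OF c c'(1) jc(2)] jc c' by simp
    then show ?thesis
      using assms[OF c c'(1) x] jet_coords_trans[OF c c'(1) jc(2) c'(2)] jc(3) by simp
  qed
  then show ?thesis by (intro exI[of _ "\<lambda>j. g (ch j) (jet_coords (ch j) j)"]) blast
qed

text \<open>Lagrangians and first integrals are functions on jets, while \<open>contr\<close> works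
  chart by chart. The transformation laws of \<open>S\<close> and \<theta> make i_S \<theta> such a
  function.\<close>

lemma contr_as_function:
  assumes \<theta>: "one_form F W \<theta>"
  shows "\<exists>h. smooth_fn F W h \<and> (\<forall>c\<in>adapted F. \<forall>x\<in>jet_img F W c. h (jet_point F c x) = \<theta> c x [S c x])"
proof -
  have "\<exists>h. \<forall>c\<in>adapted F. \<forall>x\<in>jet_img F W c. h (jet_point F c x) = \<theta> c x [S c x]"
    by (rule glue_scalar) (simp add: S_trans one_form_trans[OF _ _ _ _ \<theta>])
  then obtain h where h: "\<And>c x. c \<in> adapted F \<Longrightarrow> x \<in> jet_img F W c \<Longrightarrow> h (jet_point F c x) = \<theta> c x [S c x]"
    by blast
  have "smooth_on (jet_img F W c) (h \<circ> jet_point F c)" if c: "c \<in> adapted F" for c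
  proof -
    interpret spray_chart "jet_img F W c" "S c" by (rule spray_chart[OF W c])
    show ?thesis
      by (rule smooth_on_cong[OF open_U smooth_on_one_form_apply[OF open_U one_form_on_chart[OF \<theta> c] smooth_S]])
        (simp add: h c)
  qed
  then show ?thesis using h unfolding smooth_fn_def by blast
qed

section \<open>The forms \<open>\<theta>\<^sub>L + f dt\<close> on the jet bundle\<close>

context
  fixes \<theta> L f
  assumes L: "smooth_fn F W L" and f: "first_integral F S W f"
    and \<theta>: "form_eq F 1 W \<theta> (poincare_cartan F L + fmult (fn F f) dt)"
begin

lemma first_integral_smooth: "smooth_fn F W f"
  using f by (simp add: first_integral_def)

lemma decomposition_chart:
  "c \<in> adapted F \<Longrightarrow> x \<in> jet_img F W c \<Longrightarrow>
    \<theta> c x [v] = pc (\<lambda>z. L (jet_point F c z)) x v + f (jet_point F c x) * fst v"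
  using \<theta> by (simp add: form_eq_1 poincare_cartan_apply fmult_dt_apply del: split_paired_All)

lemma Lambda1_iff_lagrangian_for:
  assumes form: "one_form F W \<theta>"
  shows "\<theta> \<in> Lambda1 F S W \<longleftrightarrow> lagrangian_for F S W L"
proof -
  \<comment> \<open>The common condition \<open>i_S d\<theta>\<^sub>L = 0\<close> in a chart: the
    vanishing of the Lie derivative of d\<theta> and the Euler-Lagrange equation both reduce to it,
    and under it the two ranks agree.\<close>
  define EL where "EL c \<longleftrightarrow> (\<forall>x\<in>jet_img F W c. \<forall>w. ext_d1 (pc (\<lambda>z. L (jet_point F c z))) x (S c x) w = 0)" for c
  have lie\<theta>: "(\<forall>x\<in>jet_img F W c. \<forall>v w. lie S (ext_d \<theta>) c x [v, w] = 0) \<longleftrightarrow> EL c"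
    and lieL: "(\<forall>x\<in>jet_img F W c. \<forall>w. lie S (poincare_cartan F L) c x [w] = ext_d (fn F L) c x [w]) \<longleftrightarrow> EL c"
    and rank: "EL c \<Longrightarrow> x \<in> jet_img F W c \<Longrightarrow>
      form_rank (ext_d \<theta> + wedge1 (contr S (ext_d \<theta>)) dt) c x = form_rank (ext_d (poincare_cartan F L)) c x"
    if c: "c \<in> adapted F" for c x
  proof -
    interpret spray_chart "jet_img F W c" "S c" by (rule spray_chart[OF W c])
    note Lc = smooth_fn_chart[OF L c] and fc = smooth_fn_chart[OF first_integral_smooth c]
    note \<theta>c = one_form_on_chart[OF form c]
    note pf = first_integral_chart[OF f c] and dec = decomposition_chart[OF c]
    have "lie S (ext_d \<theta>) c x [v, w] = ext_d1 (\<lambda>x. ext_d1 (\<lambda>x v. \<theta> c x [v]) x (S c x)) x v w"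
      if x: "x \<in> jet_img F W c" for x v w
      using cartan_ext_d1[OF open_U x \<theta>c smooth_S] by (simp add: lie_ext_d_1)
    then show "(\<forall>x\<in>jet_img F W c. \<forall>v w. lie S (ext_d \<theta>) c x [v, w] = 0) \<longleftrightarrow> EL c"
      using euler_lagrange_iff_closed[OF Lc fc pf dec] unfolding EL_def by (simp del: split_paired_All)
    show "(\<forall>x\<in>jet_img F W c. \<forall>w. lie S (poincare_cartan F L) c x [w] = ext_d (fn F L) c x [w]) \<longleftrightarrow> EL c"
      using lie_pc_iff[OF Lc] unfolding EL_def
      by (simp add: lie_1 ext_d_0 poincare_cartan_apply fn_def del: split_paired_All)
    assume E: "EL c" and x: "x \<in> jet_img F W c"
    show "form_rank (ext_d \<theta> + wedge1 (contr S (ext_d \<theta>)) dt) c x = form_rank (ext_d (poincare_cartan F L)) c x"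
    proof (rule form_rank_cong)
      fix v w
      show "(ext_d \<theta> + wedge1 (contr S (ext_d \<theta>)) dt) c x [v, w] = ext_d (poincare_cartan F L) c x [v, w]"
        using wedge_ext_d1_pc_plus[OF Lc fc pf dec x, of v w] E x
        by (simp add: EL_def wedge1_dt contr_def ext_d_1 poincare_cartan_apply del: split_paired_All)
    qed
  qed
  have sb: "semi_basic F W \<theta>"
    using pc_vertical[OF smooth_fn_chart[OF L]] by (simp add: semi_basic_def decomposition_chart)
  have "\<theta> \<in> Lambda1 F S W \<longleftrightarrow> nondegenerate F S W \<theta> \<and> (\<forall>c\<in>adapted F. EL c)"
    using form sb lie\<theta> by (simp add: Lambda1_def form_eq_2 del: split_paired_All)
  also have "\<dots> \<longleftrightarrow> regular F W L \<and> (\<forall>c\<in>adapted F. EL c)"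
    using rank by (auto simp: nondegenerate_def regular_def has_rank_def)
  also have "\<dots> \<longleftrightarrow> lagrangian_for F S W L"
    using L lieL by (simp add: lagrangian_for_def form_eq_1 del: split_paired_All)
  finally show ?thesis .
qed

text \<open>The wedge product with dt removes f dt, and contraction of the difference with
  \<open>S\<close> gives back \<open>f\<close>, since dt(S) = 1.\<close>

lemma equivalent_poincare_cartan: "equivalent F S W \<theta> (poincare_cartan F L)"
  unfolding equivalent_def
proof
  show "form_eq F 2 W (wedge1 \<theta> dt) (wedge1 (poincare_cartan F L) dt)"
    by (simp add: form_eq_2 wedge1_dt decomposition_chart poincare_cartan_apply algebra_simps del: split_paired_All)
  have "lie S (contr S (\<theta> - poincare_cartan F L)) c x [] = 0" if c: "c \<in> adapted F" and x: "x \<in> jet_img F W c" for c x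
  proof -
    interpret spray_chart "jet_img F W c" "S c" by (rule spray_chart[OF W c])
    have "fd (\<lambda>z. contr S (\<theta> - poincare_cartan F L) c z []) x = fd (\<lambda>z. f (jet_point F c z)) x"
      by (rule fd_cong_open[OF open_U x]) (simp add: contr_def decomposition_chart c poincare_cartan_apply fst_S)
    then show ?thesis using first_integral_chart[OF f c x] by (simp add: lie_0)
  qed
  then show "form_eq F 0 W (lie S (contr S (\<theta> - poincare_cartan F L))) 0" by (simp add: form_eq_0)
qed

end

lemma equivalent_imp_decomposition:
  assumes form: "one_form F W \<theta>" and L: "smooth_fn F W L" and eq: "equivalent F S W \<theta> (poincare_cartan F L)"
  shows "\<exists>f. first_integral F S W f \<and> form_eq F 1 W \<theta> (poincare_cartan F L + fmult (fn F f) dt)"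
proof -
  obtain h where h: "smooth_fn F W h"
    "\<And>c x. c \<in> adapted F \<Longrightarrow> x \<in> jet_img F W c \<Longrightarrow> h (jet_point F c x) = \<theta> c x [S c x]"
    using contr_as_function[OF form] by blast
  \<comment> \<open>This is the contraction of \<open>\<theta> - \<theta>\<^sub>L\<close> with
    \<open>S\<close>, because \<open>\<theta>\<^sub>L(S) = L\<close>; the equivalence makes it a
    first integral.\<close>
  define f where "f j = h j - L j" for j
  have sm: "smooth_fn F W f"
    using smooth_on_diff[OF jet_open_img[OF W] smooth_fn_chart[OF h(1)] smooth_fn_chart[OF L]]
    by (simp add: smooth_fn_def f_def o_def)
  have chart: "fd (\<lambda>z. f (jet_point F c z)) x (S c x) = 0"
    "\<theta> c x [v] = pc (\<lambda>z. L (jet_point F c z)) x v + f (jet_point F c x) * fst v"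
    if c: "c \<in> adapted F" and x: "x \<in> jet_img F W c" for c x v
  proof -
    interpret spray_chart "jet_img F W c" "S c" by (rule spray_chart[OF W c])
    have f: "f (jet_point F c z) = \<theta> c z [S c z] - pc (\<lambda>z. L (jet_point F c z)) z (S c z)"
      if "z \<in> jet_img F W c" for z
      using that by (simp add: f_def h c pc_S[OF smooth_fn_chart[OF L c]])
    have "fd (\<lambda>z. f (jet_point F c z)) x = fd (\<lambda>z. contr S (\<theta> - poincare_cartan F L) c z []) x"
      by (rule fd_cong_open[OF open_U x]) (simp add: f contr_def poincare_cartan_apply)
    then show "fd (\<lambda>z. f (jet_point F c z)) x (S c x) = 0"
      using eq c x by (simp add: equivalent_def form_eq_0 lie_0)
    \<comment> \<open>With \<open>S\<close> as second argument, where dt is 1, equality of the wedge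
      products says that the two forms differ by f dt.\<close>
    have "wedge1 \<theta> dt c x [v, S c x] = wedge1 (poincare_cartan F L) dt c x [v, S c x]"
      using eq c x unfolding equivalent_def form_eq_2 by blast
    then show "\<theta> c x [v] = pc (\<lambda>z. L (jet_point F c z)) x v + f (jet_point F c x) * fst v"
      by (simp add: wedge1_dt fst_S x f poincare_cartan_apply algebra_simps)
  qed
  show ?thesis
    using sm chart by (intro exI[of _ f]) (simp add: first_integral_def form_eq_0 form_eq_1 lie_0 fn_def
        poincare_cartan_apply fmult_dt_apply del: split_paired_All)
qed

lemma first_integral_0: "first_integral F S W (\<lambda>_. 0)"
  by (simp add: first_integral_def smooth_fn_def o_def smooth_on_const form_eq_0 lie_0 fn_def
      frechet_derivative_const)

section \<open>\<open>d_J\<close>-closed forms and Lagrangians\<close>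

lemma lagrangian_for_imp_closed:
  assumes L: "lagrangian_for F S W L"
  shows "\<exists>\<theta>\<in>Lambda1 F S W. form_eq F 2 W (d_J \<theta>) 0"
proof -
  \<comment> \<open>The zero first integral is added so that the results on
    \<open>\<theta>\<^sub>L + f dt\<close> apply verbatim; the form is just
    \<open>\<theta>\<^sub>L\<close>.\<close>
  let ?\<theta> = "poincare_cartan F L + fmult (fn F (\<lambda>_. 0)) dt"
  have Ls: "smooth_fn F W L" using L by (simp add: lagrangian_for_def)
  have form: "one_form F W ?\<theta>"
    using first_integral_0 by (intro one_form_poincare_cartan_plus Ls) (simp add: first_integral_def)
  have "form_eq F 1 W ?\<theta> ?\<theta>" by (simp add: form_eq_def)
  from Lambda1_iff_lagrangian_for[OF Ls first_integral_0 this form] L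
  have "?\<theta> \<in> Lambda1 F S W" by blast
  moreover have "d_J ?\<theta> c x [v, w] = 0" if c: "c \<in> adapted F" and x: "x \<in> jet_img F W c" for c x v w
  proof -
    let ?P = "pc (\<lambda>z. L (jet_point F c z))"
    note U = jet_open_img[OF W c] and Lc = smooth_fn_chart[OF Ls c]
    have "ext_d1 (\<lambda>z u. ?P z (vert z u)) x v w = ext_d1 (\<lambda>z u. 0) x v w"
      by (rule ext_d1_cong_open[OF U x]) (simp add: vert_def pc_vertical[OF Lc])
    also have "\<dots> = 0" by (simp add: ext_d1_def frechet_derivative_const)
    finally show ?thesis
      using d_J_pc_eq_0[OF U x Lc, of v w]
      by (simp add: d_J_1 poincare_cartan_apply fmult_dt_apply)
  qed
  ultimately show ?thesis by (intro bexI[of _ ?\<theta>]) (simp_all add: form_eq_2 del: split_paired_All)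
qed

lemma closed_imp_poincare_cartan:
  assumes \<theta>: "\<theta> \<in> Lambda1 F S W" and closed: "form_eq F 2 W (d_J \<theta>) 0"
  shows "\<exists>L. lagrangian_for F S W L \<and> form_eq F 1 W \<theta> (poincare_cartan F L) \<and>
    form_eq F 1 W (lie S \<theta>) (ext_d (fn F L))"
proof -
  have form: "one_form F W \<theta>" and sb: "semi_basic F W \<theta>" using \<theta> by (auto simp: Lambda1_def)
  obtain L where L: "smooth_fn F W L"
    "\<And>c x. c \<in> adapted F \<Longrightarrow> x \<in> jet_img F W c \<Longrightarrow> L (jet_point F c x) = \<theta> c x [S c x]"
    using contr_as_function[OF form] by blast
  have chart: "\<theta> c x [v] = pc (\<lambda>z. L (jet_point F c z)) x v"
    if c: "c \<in> adapted F" and x: "x \<in> jet_img F W c" for c x v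
  proof -
    interpret spray_chart "jet_img F W c" "S c" by (rule spray_chart[OF W c])
    let ?\<Theta> = "\<lambda>x v. \<theta> c x [v]"
    note \<theta>c = one_form_on_chart[OF form c] and sbc = semi_basic_on_chart[OF sb c]
    \<comment> \<open>This says that i_S d\<theta> is semi-basic. It is \<open>d_J \<theta>\<close>
      evaluated on \<open>S\<close> and (0, w, 0): J maps them to 0 and (0, 0, w), and i_J \<theta>
      vanishes. The right side has the shape of the decomposition lemma for f = 0.\<close>
    have z: "ext_d1 ?\<Theta> x (S c x) (0, 0, w) = - fd (\<lambda>_. 0) x (0, 0, w)" if x: "x \<in> jet_img F W c" for x w
    proof -
      have "ext_d1 (\<lambda>z u. ?\<Theta> z (vert z u)) x (S c x) (0, w, 0) = ext_d1 (\<lambda>z u. 0) x (S c x) (0, w, 0)"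
        using sbc by (intro ext_d1_cong_open[OF open_U x]) (simp add: vert_def semi_basic_on_def)
      also have "\<dots> = 0" by (simp add: ext_d1_def frechet_derivative_const)
      moreover have "ext_d1 ?\<Theta> x 0 (0, w, 0) = 0"
        by (rule linear_0[OF one_form_on_linear[OF one_form_on_ext_d1[OF open_U \<theta>c] x]])
      moreover have "d_J \<theta> c x [S c x, (0, w, 0)] = 0"
        using closed c x unfolding form_eq_2 by (simp del: split_paired_All)
      moreover have "vert x (0, w, 0) = (0, 0, w)" by (simp add: vert_def)
      ultimately show ?thesis by (simp add: d_J_1 vert_S[OF x] frechet_derivative_const)
    qed
    have "\<theta> c x [v] = pc (\<lambda>z. \<theta> c z [S c z] - 0) x v + 0 * fst v"
      by (rule semi_basic_decomposition[OF \<theta>c sbc smooth_on_const z x])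
    also have "\<dots> = pc (\<lambda>z. L (jet_point F c z)) x v"
      using pc_cong_open[OF open_U x, of "\<lambda>z. \<theta> c z [S c z]" "\<lambda>z. L (jet_point F c z)"] L(2)[OF c] by simp
    finally show ?thesis .
  qed
  have dec: "form_eq F 1 W \<theta> (poincare_cartan F L)"
    by (simp add: form_eq_1 chart poincare_cartan_apply del: split_paired_All)
  have "form_eq F 1 W \<theta> (poincare_cartan F L + fmult (fn F (\<lambda>_. 0)) dt)"
    by (simp add: form_eq_1 chart poincare_cartan_apply fmult_dt_apply del: split_paired_All)
  from Lambda1_iff_lagrangian_for[OF L(1) first_integral_0 this form] \<theta>
  have lag: "lagrangian_for F S W L" by blast
  have "lie S \<theta> c x [v] = ext_d (fn F L) c x [v]" if c: "c \<in> adapted F" and x: "x \<in> jet_img F W c" for c x v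
  proof -
    have "fd (\<lambda>z. \<theta> c z [v]) x = fd (\<lambda>z. poincare_cartan F L c z [v]) x"
      by (rule fd_cong_open[OF jet_open_img[OF W c] x]) (simp add: chart c poincare_cartan_apply)
    then have "lie S \<theta> c x [v] = lie S (poincare_cartan F L) c x [v]"
      by (simp add: lie_1 chart[OF c x] poincare_cartan_apply)
    then show ?thesis using lag c x by (simp add: lagrangian_for_def form_eq_1 del: split_paired_All)
  qed
  then show ?thesis using lag dec by (auto simp: form_eq_1 simp del: split_paired_All)
qed

section \<open>Local primitives and conservative fields\<close>

lemma jet_open_chart_preimage:
  assumes c: "c \<in> adapted F" and B: "open B"
  shows "jet_open F {j \<in> W \<inter> jet_dom F c. jet_coords c j \<in> B}" (is "jet_open F ?V")
  unfolding jet_open_def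
proof (intro conjI ballI)
  show "?V \<subseteq> J1 F" by (auto simp: jet_dom_def)
  fix c' assume c': "c' \<in> adapted F"
  have "jet_img F ?V c' = jet_img F W c' \<inter> (jet_chart_dom c' c \<inter> jet_chart_trans c' c -` B)"
    using jet_coords_in_chart_dom[OF c' c] jet_coords_trans[OF c' c]
    unfolding jet_img_def by (auto simp: image_iff)
  moreover have "open (jet_chart_dom c' c \<inter> jet_chart_trans c' c -` B)"
    by (intro continuous_open_preimage[OF smooth_on_imp_continuous_on[OF smooth_on_jet_chart_trans]]
        open_jet_chart_dom adapted_is_chart c c' B)
  ultimately show "open (jet_img F ?V c')" using jet_open_img[OF W c'] by auto
qed

end

text \<open>Rank and vanishing of the Lie derivative of d\<theta> are conditions at single
  coordinate points and see the open set only through its coordinate images.\<close>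

lemma Lambda1_local:
  assumes "one_form F W \<theta>" "semi_basic F W \<theta>" "\<And>p. p \<in> W \<Longrightarrow> \<exists>V. p \<in> V \<and> \<theta> \<in> Lambda1 F S V"
  shows "\<theta> \<in> Lambda1 F S W"
proof -
  have "\<exists>V. \<theta> \<in> Lambda1 F S V \<and> x \<in> jet_img F V c" if c: "c \<in> adapted F" and x: "x \<in> jet_img F W c" for c x
  proof -
    have "jet_point F c x \<in> W" using x c by (simp add: jet_img_iff)
    then obtain V where "jet_point F c x \<in> V" "\<theta> \<in> Lambda1 F S V" using assms(3) by blast
    then show ?thesis using x c by (auto simp: jet_img_iff)
  qed
  then show ?thesis
    using assms(1,2) unfolding Lambda1_def nondegenerate_def has_rank_def form_eq_def by blast
qed

text \<open>The exterior derivative of i_S d\<theta> is the Lie derivative of d\<theta>, which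
  vanishes, so i_S d\<theta> has a primitive on a coordinate ball. Its negative is \<open>f\<close>,
  and L = i_S \<theta> - f.\<close>

lemma local_decomposition:
  assumes W: "jet_open F W" and \<theta>: "\<theta> \<in> Lambda1 F S W" and p: "p \<in> W"
  shows "\<exists>V L f. jet_open F V \<and> p \<in> V \<and> V \<subseteq> W \<and> smooth_fn F V L \<and> first_integral F S V f \<and>
    form_eq F 1 V \<theta> (poincare_cartan F L + fmult (fn F f) dt)"
proof (cases "\<exists>c\<in>adapted F. p \<in> jet_dom F c")
  case False
  text \<open>A jet outside every adapted chart (there is none, but this need not be known) is an open point.\<close>
  then have e: "jet_img F {p} c = {}" if "c \<in> adapted F" for c using that by (auto simp: jet_img_def)
  have "jet_open F {p}" using e p W by (auto simp: jet_open_def)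
  moreover have "smooth_fn F {p} (\<lambda>_. 0)" "first_integral F S {p} (\<lambda>_. 0)"
    by (auto simp: smooth_fn_def o_def smooth_on_const first_integral_def form_eq_def e)
  moreover have "form_eq F 1 {p} \<theta> (poincare_cartan F (\<lambda>_. 0) + fmult (fn F (\<lambda>_. 0)) dt)"
    by (simp add: form_eq_def e)
  ultimately show ?thesis using p by blast
next
  case True
  then obtain c where c: "c \<in> adapted F" and pc: "p \<in> jet_dom F c" by blast
  let ?x0 = "jet_coords c p" and ?\<Theta> = "\<lambda>x v. \<theta> c x [v]"
  have form: "one_form F W \<theta>" and sb: "semi_basic F W \<theta>" using \<theta> by (auto simp: Lambda1_def)
  have "?x0 \<in> jet_img F W c" using p pc by (auto simp: jet_img_def)
  then obtain r where r: "r > 0" "ball ?x0 r \<subseteq> jet_img F W c"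
    using jet_open_img[OF W c] openE by blast
  define V where "V = {j \<in> W \<inter> jet_dom F c. jet_coords c j \<in> ball ?x0 r}"
  have V: "jet_open F V" unfolding V_def by (rule jet_open_chart_preimage[OF W c open_ball])
  have VW: "V \<subseteq> W" and pV: "p \<in> V" using p pc r by (auto simp: V_def)
  have imgV: "jet_img F V c = ball ?x0 r"
  proof
    show "jet_img F V c \<subseteq> ball ?x0 r" by (auto simp: V_def jet_img_def)
    show "ball ?x0 r \<subseteq> jet_img F V c"
    proof
      fix x assume x: "x \<in> ball ?x0 r"
      then have "x \<in> jet_img F W c" using r by blast
      then show "x \<in> jet_img F V c" using x c unfolding jet_img_iff[OF c] V_def by simp
    qed
  qed
  interpret spray_chart "ball ?x0 r" "S c" using spray_chart[OF V c] by (simp add: imgV)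
  note \<theta>c = one_form_on_chart[OF one_form_subset[OF form VW] c, unfolded imgV]
    and sbc = semi_basic_on_chart[OF semi_basic_subset[OF sb VW] c, unfolded imgV]
  have closed: "ext_d1 (\<lambda>x. ext_d1 ?\<Theta> x (S c x)) x v w = 0" if x: "x \<in> ball ?x0 r" for x v w
  proof -
    have "lie S (ext_d \<theta>) c x [v, w] = 0"
      using \<theta> c x r by (auto simp: Lambda1_def form_eq_2 simp del: split_paired_All)
    then show ?thesis using cartan_ext_d1[OF open_U x \<theta>c smooth_S, of v w] by (simp add: lie_ext_d_1)
  qed
  obtain g' where g': "smooth_on (ball ?x0 r) g'" "\<And>x. x \<in> ball ?x0 r \<Longrightarrow> fd g' x = ext_d1 ?\<Theta> x (S c x)"
    using poincare_lemma_ball[OF one_form_on_contr_ext_d1[OF open_U \<theta>c smooth_S] closed] by blast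
  define g where "g x = - g' x" for x
  have g: "smooth_on (ball ?x0 r) g" unfolding g_def by (rule smooth_on_uminus[OF open_U g'(1)])
  have dg: "fd g x v = - ext_d1 ?\<Theta> x (S c x) v" if "x \<in> ball ?x0 r" for x v
    using fd_unique[OF has_derivative_minus[OF smooth_on_has_derivative[OF g'(1) that]]]
    by (simp add: g_def[abs_def] g'(2)[OF that])
  obtain h where h: "smooth_fn F W h"
    "\<And>c x. c \<in> adapted F \<Longrightarrow> x \<in> jet_img F W c \<Longrightarrow> h (jet_point F c x) = \<theta> c x [S c x]"
    using contr_as_function[OF W form] by blast
  define f where "f j = g (jet_coords c j)" for j
  define L where "L j = h j - f j" for j
  have fc: "f (jet_point F c x) = g x" if "x \<in> ball ?x0 r" for x
    using that imgV jet_img_iff[OF c, of x V] by (simp add: f_def)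
  \<comment> \<open>Every jet of \<open>V\<close> lies in the domain of \<open>c\<close>, so from
    any other adapted chart the transition to \<open>c\<close> is defined on the whole image of
    \<open>V\<close>.\<close>
  have dom: "x \<in> jet_chart_dom c' c" if c': "c' \<in> adapted F" and x: "x \<in> jet_img F V c'" for c' x
  proof -
    have "jet_point F c' x \<in> V" "jet_point F c' x \<in> jet_dom F c'" "jet_coords c' (jet_point F c' x) = x"
      using x c' by (auto simp: jet_img_iff)
    then show ?thesis using jet_coords_in_chart_dom[OF c' c, of "jet_point F c' x"] by (simp add: V_def)
  qed
  have trans: "jet_chart_trans c' c x \<in> ball ?x0 r" if c': "c' \<in> adapted F" and x: "x \<in> jet_img F V c'" for c' x
    using jet_point_trans(1)[OF c' c x dom[OF c' x]] imgV by simp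
  have fs: "smooth_fn F V f"
    unfolding smooth_fn_def
  proof
    fix c' assume c': "c' \<in> adapted F"
    note U' = jet_open_img[OF V c']
    have "smooth_on (jet_img F V c') (\<lambda>x. g (jet_chart_trans c' c x))"
      using trans[OF c'] dom[OF c']
      by (intro smooth_on_compose[OF U' open_ball _ _ g, where f = "jet_chart_trans c' c"]
          smooth_on_subset[OF smooth_on_jet_chart_trans[OF c' c]]) auto
    moreover have "g (jet_chart_trans c' c x) = (f \<circ> jet_point F c') x" if x: "x \<in> jet_img F V c'" for x
      using jet_point_trans(2)[OF c' c x dom[OF c' x]] fc[OF trans[OF c' x]] by simp
    ultimately show "smooth_on (jet_img F V c') (f \<circ> jet_point F c')" using smooth_on_cong[OF U'] by blast
  qed
  have Sf: "fd (\<lambda>z. f (jet_point F c z)) x (S c x) = 0" if x: "x \<in> ball ?x0 r" for x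
  proof -
    have "fd (\<lambda>z. f (jet_point F c z)) x = fd g x" by (rule fd_cong_open[OF open_ball x fc])
    \<comment> \<open>dg(S) = -d\<theta>(S, S) = 0 by skewness, so any such primitive is a first
      integral.\<close>
    then show ?thesis using dg[OF x] by (simp add: ext_d1_def)
  qed
  have "fd (\<lambda>z. f (jet_point F c' z)) x (S c' x) = 0" if c': "c' \<in> adapted F" and x: "x \<in> jet_img F V c'" for c' x
    using fd_fn_trans[OF V c' c x dom[OF c' x] fs, of "S c' x"] S_trans[OF V c' c x dom[OF c' x]]
      Sf[OF trans[OF c' x]] by simp
  then have fi: "first_integral F S V f"
    using fs by (simp add: first_integral_def form_eq_0 lie_0 fn_def)
  have Ls: "smooth_fn F V L"
    using smooth_on_diff[OF jet_open_img[OF V] smooth_fn_chart[OF smooth_fn_subset[OF h(1) VW]] smooth_fn_chart[OF fs]]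
    by (simp add: smooth_fn_def L_def o_def)
  let ?\<eta> = "poincare_cartan F L + fmult (fn F f) dt"
  have eq: "\<theta> c x [v] = ?\<eta> c x [v]" if x: "x \<in> ball ?x0 r" for x v
  proof -
    have "\<theta> c x [v] = pc (\<lambda>z. \<theta> c z [S c z] - g z) x v + g x * fst v"
      by (rule semi_basic_decomposition[OF \<theta>c sbc g _ x]) (simp add: dg)
    also have "pc (\<lambda>z. \<theta> c z [S c z] - g z) x v = pc (\<lambda>z. L (jet_point F c z)) x v"
    proof (rule pc_cong_open[OF open_U x])
      fix z assume z: "z \<in> ball ?x0 r"
      then have "z \<in> jet_img F W c" using r by blast
      then show "\<theta> c z [S c z] - g z = L (jet_point F c z)" by (simp add: L_def h(2)[OF c] fc[OF z])
    qed
    finally show ?thesis by (simp add: poincare_cartan_apply fmult_dt_apply fc[OF x])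
  qed
  \<comment> \<open>Both sides obey the transformation law of one-forms on \<open>V\<close>, so
    equality in the chart \<open>c\<close> gives equality in each adapted chart.\<close>
  have "\<theta> c' x [v] = ?\<eta> c' x [v]" if c': "c' \<in> adapted F" and x: "x \<in> jet_img F V c'" for c' x v
    using one_form_trans[OF V c' c x dom[OF c' x] one_form_subset[OF form VW], of v]
      one_form_trans[OF V c' c x dom[OF c' x] one_form_poincare_cartan_plus[OF V Ls fs], of v]
      eq[OF trans[OF c' x]] by simp
  then have "form_eq F 1 V \<theta> ?\<eta>" unfolding form_eq_1 by blast
  then show ?thesis using V pV VW Ls fi by blast
qed

lemma conservative_iff:
  assumes W: "jet_open F W"
  shows "conservative_lagrangian_on F S W \<longleftrightarrow> (\<exists>\<theta>\<in>Lambda1 F S W. \<not> form_eq F 2 W (d_J \<theta>) 0)"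
proof
  assume "conservative_lagrangian_on F S W"
  then obtain \<theta> where form: "one_form F W \<theta>" and sb: "semi_basic F W \<theta>"
    and n: "\<not> form_eq F 2 W (d_J \<theta>) 0"
    and loc: "\<And>p. p \<in> W \<Longrightarrow> \<exists>V L. jet_open F V \<and> p \<in> V \<and> V \<subseteq> W \<and> lagrangian_for F S V L \<and>
           equivalent F S V \<theta> (poincare_cartan F L)"
    unfolding conservative_lagrangian_on_def by blast
  \<comment> \<open>A form equivalent to \<open>\<theta>\<^sub>L\<close> near each jet is locally
    \<open>\<theta>\<^sub>L + f dt\<close>, hence locally in \<open>Lambda1\<close>; the local
    memberships are then collected over \<open>W\<close>.\<close>
  have "\<theta> \<in> Lambda1 F S W"
  proof (rule Lambda1_local[OF form sb])
    fix p assume "p \<in> W"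
    then obtain V L where V: "jet_open F V" "p \<in> V" "V \<subseteq> W" and L: "lagrangian_for F S V L"
      and eq: "equivalent F S V \<theta> (poincare_cartan F L)"
      using loc by blast
    have Ls: "smooth_fn F V L" using L by (simp add: lagrangian_for_def)
    note form' = one_form_subset[OF form V(3)]
    obtain f where "first_integral F S V f" "form_eq F 1 V \<theta> (poincare_cartan F L + fmult (fn F f) dt)"
      using equivalent_imp_decomposition[OF V(1) form' Ls eq] by blast
    then have "\<theta> \<in> Lambda1 F S V" using Lambda1_iff_lagrangian_for[OF V(1) Ls _ _ form'] L by blast
    then show "\<exists>V. p \<in> V \<and> \<theta> \<in> Lambda1 F S V" using V by blast
  qed
  then show "\<exists>\<theta>\<in>Lambda1 F S W. \<not> form_eq F 2 W (d_J \<theta>) 0" using n by blast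
next
  assume "\<exists>\<theta>\<in>Lambda1 F S W. \<not> form_eq F 2 W (d_J \<theta>) 0"
  then obtain \<theta> where \<theta>: "\<theta> \<in> Lambda1 F S W" and n: "\<not> form_eq F 2 W (d_J \<theta>) 0" by blast
  have form: "one_form F W \<theta>" and sb: "semi_basic F W \<theta>" using \<theta> by (auto simp: Lambda1_def)
  have loc: "\<exists>V L. jet_open F V \<and> p \<in> V \<and> V \<subseteq> W \<and> lagrangian_for F S V L \<and>
           equivalent F S V \<theta> (poincare_cartan F L)" if p: "p \<in> W" for p
  proof -
    obtain V L f where V: "jet_open F V" "p \<in> V" "V \<subseteq> W" and L: "smooth_fn F V L"
      and f: "first_integral F S V f" and dec: "form_eq F 1 V \<theta> (poincare_cartan F L + fmult (fn F f) dt)"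
      using local_decomposition[OF W \<theta> p] by blast
    have "lagrangian_for F S V L"
      using Lambda1_iff_lagrangian_for[OF V(1) L f dec one_form_subset[OF form V(3)]] Lambda1_subset[OF \<theta> V(3)]
      by blast
    then show ?thesis using V equivalent_poincare_cartan[OF V(1) L f dec] by blast
  qed
  then have "locally_lagrangian_on F S W"
    unfolding locally_lagrangian_on_def lagrangian_on_def by blast
  then show "conservative_lagrangian_on F S W"
    unfolding conservative_lagrangian_on_def using form sb n loc by blast
qed

lemma lagrangian_on_iff:
  "jet_open F W \<Longrightarrow> lagrangian_on F S W \<longleftrightarrow> (\<exists>\<theta>\<in>Lambda1 F S W. form_eq F 2 W (d_J \<theta>) 0)"
  unfolding lagrangian_on_def using lagrangian_for_imp_closed closed_imp_poincare_cartan by blast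

end

text \<open>In the closed case L = i_S \<theta> is defined wherever \<theta> is, so the first and
  third clauses stay on \<open>W\<close>; the second applies the first near each jet. The last two
  clauses rest on primitives of -i_S d\<theta>, so there \<open>L\<close> and \<open>f\<close> are
  found near each jet while \<theta> lives on \<open>W\<close>.\<close>

theorem proposition4p6:
  fixes F :: "('m::{t2_space, second_countable_topology}, 'n::finite) fibration"
    and S :: "('m, 'n) jvec"
    and W :: "'m jet set"
  assumes "fibred_manifold F" and "semispray F S" and "jet_open F W"
  shows
    "(lagrangian_on F S W \<longleftrightarrow> (\<exists>\<theta>\<in>Lambda1 F S W. form_eq F 2 W (d_J \<theta>) 0)) \<and>
     (locally_lagrangian_on F S W \<longleftrightarrow>
        (\<forall>p\<in>W. \<exists>V. jet_open F V \<and> p \<in> V \<and> V \<subseteq> W \<and>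
           (\<exists>\<theta>\<in>Lambda1 F S V. form_eq F 2 V (d_J \<theta>) 0))) \<and>
     (\<forall>\<theta>\<in>Lambda1 F S W. form_eq F 2 W (d_J \<theta>) 0 \<longrightarrow>
        (\<exists>L. smooth_fn F W L \<and> form_eq F 1 W \<theta> (poincare_cartan F L) \<and>
           form_eq F 1 W (lie S \<theta>) (ext_d (fn F L)))) \<and>
     (conservative_lagrangian_on F S W \<longleftrightarrow>
        (\<exists>\<theta>\<in>Lambda1 F S W. \<not> form_eq F 2 W (d_J \<theta>) 0)) \<and>
     (\<forall>\<theta>\<in>Lambda1 F S W. \<not> form_eq F 2 W (d_J \<theta>) 0 \<longrightarrow>
        (\<forall>p\<in>W. \<exists>V L f. jet_open F V \<and> p \<in> V \<and> V \<subseteq> W \<and>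
           smooth_fn F V L \<and> first_integral F S V f \<and>
           form_eq F 1 V \<theta> (poincare_cartan F L + fmult (fn F f) dt)))"
proof -
  interpret fibred_spray F S by unfold_locales (rule assms)+
  note W = assms(3)
  have "locally_lagrangian_on F S W \<longleftrightarrow>
      (\<forall>p\<in>W. \<exists>V. jet_open F V \<and> p \<in> V \<and> V \<subseteq> W \<and> (\<exists>\<theta>\<in>Lambda1 F S V. form_eq F 2 V (d_J \<theta>) 0))"
    unfolding locally_lagrangian_on_def by (simp add: lagrangian_on_iff cong: conj_cong)
  moreover have "\<exists>L. smooth_fn F W L \<and> form_eq F 1 W \<theta> (poincare_cartan F L) \<and>
      form_eq F 1 W (lie S \<theta>) (ext_d (fn F L))"
    if "\<theta> \<in> Lambda1 F S W" "form_eq F 2 W (d_J \<theta>) 0" for \<theta>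
    using closed_imp_poincare_cartan[OF W that] unfolding lagrangian_for_def by blast
  ultimately show ?thesis
    by (intro conjI lagrangian_on_iff[OF W] conservative_iff[OF W] ballI impI local_decomposition[OF W]) simp_all
qed

end
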